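(* In the Poisson multigraph model on the vertex set $[n]$ (for each unordered pair $\{i,j\}$ of distinct vertices, infinitely many parallel edges with costs given by the points of an intensity-$1$ Poisson process on $(0,\infty)$, independent over pairs), let $T_1$ be the minimum spanning tree and, for $k\ge2$, let $T_k$ be the minimum spanning tree after deleting the edges of $T_1,\dots,T_{k-1}$, and let $w(T_k)$ be its total cost. Then for each $k\ge1$, $\mathbb E\, w(T_k)\to\gamma_k$ as $n\to\infty$, where $\gamma_k$ is the constant such that $w(T_k)\to\gamma_k$ in probability.
   Context: It is known (from the same paper) that for each $k\ge1$ there is a constant $\gamma_k$ with $w(T_k)\to\gamma_k$ in probability in this model as $n\to\infty$. *)

theory Defs
  imports "HOL-Probability.Probability"
begin

text \<open>Poisson multigraph on vertex set [n] = {0..<n}.  An edge is a triple (i,j,m)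
  with i < j < n: the m-th (0-based, in increasing order of cost) of the infinitely many
  parallel edges between i and j.\<close>

type_synonym edge = "nat \<times> nat \<times> nat"

definition edges :: "nat \<Rightarrow> edge set" where
  "edges n = {(i, j, m). i < j \<and> j < n}"

text \<open>Sample space: i.i.d. Exp(1) inter-arrival times X e, one for each edge index.
  The points of the rate-1 Poisson process on (0,oo) attached to the pair {i,j} are the
  partial sums X(i,j,0) + ... + X(i,j,m), m = 0,1,2,...\<close>

definition exp1 :: "real measure" where
  "exp1 = density lborel (exponential_density 1)"

definition poisson_mg :: "nat \<Rightarrow> (edge \<Rightarrow> real) measure" where
  "poisson_mg n = PiM (edges n) (\<lambda>_. exp1)"

definition cost :: "(edge \<Rightarrow> real) \<Rightarrow> edge \<Rightarrow> real" where
  "cost X = (\<lambda>(i, j, m). \<Sum>l\<le>m. X (i, j, l))"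

text \<open>Graph notions for multigraphs on {0..<n} with edge sets of triples.\<close>

definition adj :: "edge set \<Rightarrow> (nat \<times> nat) set" where
  "adj F = {(i, j). \<exists>m. (i, j, m) \<in> F} \<union> {(j, i). \<exists>m. (i, j, m) \<in> F}"

definition connected_on :: "nat \<Rightarrow> edge set \<Rightarrow> bool" where
  "connected_on n F \<longleftrightarrow> (\<forall>u<n. \<forall>v<n. (u, v) \<in> (adj F)\<^sup>*)"

text \<open>A spanning tree of [n] using edges from A: n-1 edges, connecting all vertices.\<close>
definition spanning_tree :: "nat \<Rightarrow> edge set \<Rightarrow> edge set \<Rightarrow> bool" where
  "spanning_tree n A F \<longleftrightarrow> F \<subseteq> A \<and> finite F \<and> card F = n - 1 \<and> connected_on n F"

definition weight :: "(edge \<Rightarrow> real) \<Rightarrow> edge set \<Rightarrow> real" where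
  "weight c F = (\<Sum>e\<in>F. c e)"

definition is_MST :: "nat \<Rightarrow> (edge \<Rightarrow> real) \<Rightarrow> edge set \<Rightarrow> edge set \<Rightarrow> bool" where
  "is_MST n c A F \<longleftrightarrow> spanning_tree n A F \<and>
     (\<forall>F'. spanning_tree n A F' \<longrightarrow> weight c F \<le> weight c F')"

text \<open>Minimum spanning tree of the multigraph with the edges R deleted
  (a.s. unique, since costs are a.s. distinct).\<close>
definition next_mst :: "nat \<Rightarrow> (edge \<Rightarrow> real) \<Rightarrow> edge set \<Rightarrow> edge set" where
  "next_mst n c R = (SOME F. is_MST n c (edges n - R) F)"

text \<open>used n c k = edge set of T_1 \<union> ... \<union> T_k.\<close>
primrec used :: "nat \<Rightarrow> (edge \<Rightarrow> real) \<Rightarrow> nat \<Rightarrow> edge set" where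
  "used n c 0 = {}"
| "used n c (Suc k) = used n c k \<union> next_mst n c (used n c k)"

text \<open>T_k for k \<ge> 1.\<close>
definition kth_mst :: "nat \<Rightarrow> (edge \<Rightarrow> real) \<Rightarrow> nat \<Rightarrow> edge set" where
  "kth_mst n c k = next_mst n c (used n c (k - 1))"

text \<open>w(T_k) as a random variable on the Poisson multigraph model.\<close>
definition wT :: "nat \<Rightarrow> nat \<Rightarrow> (edge \<Rightarrow> real) \<Rightarrow> real" where
  "wT n k X = weight (cost X) (kth_mst n (cost X) k)"

end

theory Submission
  imports Defs
begin

text \<open>Convergence in probability upgrades to convergence of means once the \<open>w(T\<^sub>k)\<close> are uniformly
  integrable. Almost surely \<open>T\<^sub>k\<close> is the Kruskal tree of what the previous trees leave over, so the
  deleted edges can be described causally: whether an edge is left over depends only on cheaper edges.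
  Let \<open>D\<^sub>t(u,v)\<close> say that \<open>u\<close> and \<open>v\<close> are separated by the edges of cost below \<open>t\<close>
  left over after \<open>T\<^sub>1,\<dots>,T\<^bsub>k-1\<^esub>\<close>. The component of \<open>v\<close> at time \<open>t\<close> contains at most one vertex
  more than \<open>T\<^sub>k\<close> has edges of cost below \<open>t\<close>; hence \<open>n\<close> times the number of edges
  of \<open>T\<^sub>k\<close> of cost at least \<open>t\<close> is at most twice the number of separated pairs.
  By memorylessness the expected integral of \<open>D\<^sub>t(u,v)\<close> over \<open>t \<ge> s\<close> is the expected number
  of points \<open>c \<ge> s\<close> of the pair with \<open>D\<^sub>c(u,v)\<close>, and each such point is an edge
  of \<open>T\<^sub>1 \<union> \<dots> \<union> T\<^sub>k\<close>. Altogether \<open>n E (\<Sum>e\<in>T\<^sub>k. (c e - s)\<^sup>+)\<close> is at most twice the expected number of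
  edges of cost at least \<open>s\<close> in \<open>T\<^sub>1,\<dots>,T\<^sub>k\<close>. With \<open>s = 0\<close> this gives \<open>E w(T\<^sub>k) \<le> 2k\<close>,
  then Markov's inequality and \<open>s = C/n\<close> give a bound \<open>4k\<^sup>2/C\<close>, while the
  truncated costs \<open>min (c e) (C/n)\<close> add up to at most \<open>C\<close>.\<close>

subsection \<open>Kruskal's description of the successive trees\<close>

lemma adj_insert: "adj (insert (a, b, m) F) = insert (a, b) (insert (b, a) (adj F))"
  unfolding adj_def by auto

lemma adj_mono: "F \<subseteq> G \<Longrightarrow> adj F \<subseteq> adj G"
  unfolding adj_def by blast

lemma sym_adj_rtrancl: "sym ((adj F)\<^sup>*)"
  by (rule sym_rtrancl) (auto simp: adj_def sym_def)

lemma adj_rtrancl_sym: "(u, v) \<in> (adj F)\<^sup>* \<Longrightarrow> (v, u) \<in> (adj F)\<^sup>*"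
  using sym_adj_rtrancl by (rule symD)

lemma adj_rtranclI: "(u, v, m) \<in> F \<or> (v, u, m) \<in> F \<Longrightarrow> (u, v) \<in> (adj F)\<^sup>*"
  by (rule r_into_rtrancl) (auto simp: adj_def)

lemma adj_rtrancl_mono: "F \<subseteq> G \<Longrightarrow> (u, v) \<in> (adj F)\<^sup>* \<Longrightarrow> (u, v) \<in> (adj G)\<^sup>*"
  using rtrancl_mono[OF adj_mono] by blast

lemma adj_rtrancl_subset:
  assumes "\<And>i j m. (i, j, m) \<in> F \<Longrightarrow> (i, j) \<in> (adj G)\<^sup>*" and "(u, v) \<in> (adj F)\<^sup>*"
  shows "(u, v) \<in> (adj G)\<^sup>*"
proof -
  have "adj F \<subseteq> (adj G)\<^sup>*"
  proof (rule subrelI)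
    fix x y
    assume "(x, y) \<in> adj F"
    then obtain m where "(x, y, m) \<in> F \<or> (y, x, m) \<in> F"
      by (auto simp: adj_def)
    then show "(x, y) \<in> (adj G)\<^sup>*"
      using assms(1)[of x y m] assms(1)[of y x m, THEN adj_rtrancl_sym] by argo
  qed
  then show ?thesis
    using rtrancl_subset_rtrancl[of "adj F" "adj G"] assms(2) by (meson subsetD)
qed

text \<open>A walk can be shortened until it crosses the new edge at most once; the two last
  alternatives are the two directions of that crossing.\<close>

lemma adj_rtrancl_insertD:
  assumes "(x, y) \<in> (adj (insert (i, j, m) G))\<^sup>*"
  shows "(x, y) \<in> (adj G)\<^sup>* \<or> (x, i) \<in> (adj G)\<^sup>* \<and> (j, y) \<in> (adj G)\<^sup>*
    \<or> (x, j) \<in> (adj G)\<^sup>* \<and> (i, y) \<in> (adj G)\<^sup>*"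
  using assms
proof (induction rule: rtrancl_induct)
  case base
  then show ?case by blast
next
  case (step y z)
  from step.hyps(2) consider "(y, z) \<in> adj G" | "y = i" "z = j" | "y = j" "z = i"
    by (auto simp: adj_insert)
  then show ?case
  proof cases
    case 1
    then show ?thesis using step.IH by (meson rtrancl.rtrancl_into_rtrancl)
  next
    case 2
    then show ?thesis using step.IH by (auto dest: adj_rtrancl_sym)
  next
    case 3
    then show ?thesis using step.IH by (auto dest: adj_rtrancl_sym)
  qed
qed

lemma rtrancl_crossing:
  assumes "(x, y) \<in> R\<^sup>*" "P x" "\<not> P y"
  obtains a b where "(a, b) \<in> R" "P a" "\<not> P b"
  using assms by (induction rule: rtrancl_induct) auto

text \<open>Applied below to sets of edges joining two given vertices, where an inclusion-minimal
  set plays the role of a path.\<close>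

lemma ex_minimal_subset:
  assumes "finite F" "P F"
  obtains G where "G \<subseteq> F" "P G" "\<And>H. H \<subset> G \<Longrightarrow> \<not> P H"
  using assms
proof (induction F arbitrary: thesis rule: finite_psubset_induct)
  case (psubset F)
  show ?case
  proof (cases "\<exists>H. H \<subset> F \<and> P H")
    case True
    then obtain H where H: "H \<subset> F" "P H" by blast
    show ?thesis
    proof (rule psubset.IH[OF H(1) _ H(2)])
      fix G assume "G \<subseteq> H" "P G" "\<And>H. H \<subset> G \<Longrightarrow> \<not> P H"
      then show thesis using H(1) psubset.prems(1)[of G] by auto
    qed
  next
    case False
    then show ?thesis using psubset.prems by blast
  qed
qed

text \<open>Send each reachable \<open>u\<close> other than \<open>v\<close> to the last edge of a
  shortest walk from \<open>v\<close>. The vertex \<open>u\<close> is recovered as the endpoint of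
  that edge farther from \<open>v\<close>, so the map into \<open>F\<close> is injective.\<close>

lemma card_reachable_le:
  assumes "finite F"
  shows "finite {u. (v, u) \<in> (adj F)\<^sup>*}" "card {u. (v, u) \<in> (adj F)\<^sup>*} \<le> card F + 1"
proof -
  define R where "R = {u. (v, u) \<in> (adj F)\<^sup>*}"
  define d where "d u = (LEAST m. (v, u) \<in> adj F ^^ m)" for u
  have ex: "\<exists>e\<in>F. \<exists>w m. d w < d u \<and> (e = (w, u, m) \<or> e = (u, w, m))" if "u \<in> R - {v}" for u
  proof -
    have "(v, u) \<in> adj F ^^ d u"
      unfolding d_def by (rule LeastI_ex) (use that in \<open>simp add: R_def rtrancl_imp_UN_relpow rtrancl_is_UN_relpow\<close>)
    moreover have "d u \<noteq> 0"
      using calculation that by (cases "d u") auto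
    ultimately obtain m w where m: "d u = Suc m" "(v, w) \<in> adj F ^^ m" "(w, u) \<in> adj F"
      by (metis not0_implies_Suc relpow_Suc_E)
    have "d w \<le> m"
      unfolding d_def using m(2) by (rule Least_le)
    then have "d w < d u"
      using m(1) by simp
    moreover obtain l where "(w, u, l) \<in> F \<or> (u, w, l) \<in> F"
      using m(3) by (auto simp: adj_def)
    ultimately show ?thesis
      by metis
  qed
  define f where "f u = (SOME e. e \<in> F \<and> (\<exists>w m. d w < d u \<and> (e = (w, u, m) \<or> e = (u, w, m))))" for u
  have f: "f u \<in> F \<and> (\<exists>w m. d w < d u \<and> (f u = (w, u, m) \<or> f u = (u, w, m)))" if "u \<in> R - {v}" for u
    unfolding f_def by (rule someI_ex) (use ex[OF that] in blast)
  have inj: "inj_on f (R - {v})"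
  proof (rule inj_onI)
    fix x y
    assume "x \<in> R - {v}" "y \<in> R - {v}" "f x = f y"
    \<comment> \<open>If one edge were chosen for two different vertices, these would be its two
      endpoints, each farther from \<open>v\<close> than the other.\<close>
    with f[of x] f[of y] show "x = y"
      by (metis Pair_inject not_less_iff_gr_or_eq)
  qed
  have sub: "f ` (R - {v}) \<subseteq> F"
    using f by blast
  have fin: "finite (R - {v})"
    using inj_on_finite[OF inj sub assms] .
  have "card (R - {v}) \<le> card F"
    using card_inj_on_le[OF inj sub assms] .
  moreover have "v \<in> R"
    by (simp add: R_def)
  ultimately have "card R \<le> card F + 1" "finite R"
    using fin by (auto simp: card_Diff_singleton)
  then show "finite {u. (v, u) \<in> (adj F)\<^sup>*}" "card {u. (v, u) \<in> (adj F)\<^sup>*} \<le> card F + 1"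
    by (auto simp: R_def)
qed

lemma connected_on_card:
  assumes "connected_on n F" "finite F"
  shows "n \<le> card F + 1"
proof (cases "n = 0")
  case False
  then have "{..<n} \<subseteq> {u. (0, u) \<in> (adj F)\<^sup>*}"
    using assms(1) by (auto simp: connected_on_def)
  from card_mono[OF card_reachable_le(1)[OF assms(2)] this] show ?thesis
    using card_reachable_le(2)[OF assms(2), of 0] by simp
qed simp

lemma connected_on_Diff_insert:
  assumes "connected_on n F" "(i, j) \<in> (adj (insert e' (F - {(i, j, m)})))\<^sup>*"
  shows "connected_on n (insert e' (F - {(i, j, m)}))"
proof -
  have "(u, v) \<in> (adj (insert e' (F - {(i, j, m)})))\<^sup>*" if "(u, v) \<in> (adj F)\<^sup>*" for u v
  proof (rule adj_rtrancl_subset[OF _ that])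
    fix a b k
    assume "(a, b, k) \<in> F"
    then show "(a, b) \<in> (adj (insert e' (F - {(i, j, m)})))\<^sup>*"
      using assms(2) by (cases "(a, b, k) = (i, j, m)") (auto simp: adj_def)
  qed
  then show ?thesis
    using assms(1) by (auto simp: connected_on_def)
qed

text \<open>Otherwise the remaining \<open>n - 2\<close> edges would still connect all
  \<open>n\<close> vertices, against \<open>connected_on_card\<close>.\<close>

lemma spanning_tree_bridge:
  assumes "spanning_tree n A F" "(i, j, m) \<in> F"
  shows "(i, j) \<notin> (adj (F - {(i, j, m)}))\<^sup>*"
proof
  assume con: "(i, j) \<in> (adj (F - {(i, j, m)}))\<^sup>*"
  have F: "finite F" "card F = n - 1" "connected_on n F"
    using assms(1) by (auto simp: spanning_tree_def)
  have "(u, v) \<in> (adj (F - {(i, j, m)}))\<^sup>*" if "(u, v) \<in> (adj F)\<^sup>*" for u v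
  proof (rule adj_rtrancl_subset[OF _ that])
    fix a b k
    assume "(a, b, k) \<in> F"
    then show "(a, b) \<in> (adj (F - {(i, j, m)}))\<^sup>*"
      using con by (cases "(a, b, k) = (i, j, m)") (auto simp: adj_def)
  qed
  then have "connected_on n (F - {(i, j, m)})"
    using F(3) by (auto simp: connected_on_def)
  then have "n \<le> card (F - {(i, j, m)}) + 1"
    using F(1) by (intro connected_on_card) auto
  moreover have "card F > 0"
    using F(1) assms(2) card_gt_0_iff by blast
  ultimately show False
    using F assms(2) by (simp add: card_Diff_singleton)
qed

text \<open>Replacing the tree edge by \<open>e'\<close> keeps the number of edges and the
  connectivity, so minimality of the total weight compares the two costs.\<close>

lemma is_MST_exchange:
  assumes "is_MST n c A F" "(i, j, m) \<in> F" "e' \<in> A - F"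
    and con: "(i, j) \<in> (adj (insert e' (F - {(i, j, m)})))\<^sup>*"
  shows "c (i, j, m) \<le> c e'"
proof -
  let ?e = "(i, j, m)"
  let ?F = "insert e' (F - {?e})"
  have F: "F \<subseteq> A" "finite F" "card F = n - 1" "connected_on n F"
    using assms(1) by (auto simp: is_MST_def spanning_tree_def)
  have "card F > 0"
    using F(2) assms(2) card_gt_0_iff by blast
  then have "card ?F = card F"
    using F assms by (simp add: card_Diff_singleton)
  then have "spanning_tree n A ?F"
    using F assms connected_on_Diff_insert[OF F(4) con] by (auto simp: spanning_tree_def)
  then have "weight c F \<le> weight c ?F"
    using assms(1) by (auto simp: is_MST_def)
  moreover have "weight c ?F = c e' + weight c (F - {?e})"
    using F assms by (simp add: weight_def)
  moreover have "weight c F = c ?e + weight c (F - {?e})"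
    unfolding weight_def by (rule sum.remove) (use F assms in auto)
  ultimately show ?thesis by simp
qed

section \<open>Kruskal's rule and the minimum spanning tree\<close>

text \<open>The edges that Kruskal's algorithm discards. The test uses all strictly cheaper edges of
  \<open>A\<close>, not only the accepted ones, which avoids a recursion along the costs;
  \<open>adj_rtrancl_kruskal\<close> shows that both tests agree.\<close>

definition reject :: "(edge \<Rightarrow> real) \<Rightarrow> edge set \<Rightarrow> edge set" where
  "reject c A = {(i, j, m). (i, j, m) \<in> A \<and> (i, j) \<in> (adj {e \<in> A. c e < c (i, j, m)})\<^sup>*}"

lemma reject_subset: "reject c A \<subseteq> A"
  by (auto simp: reject_def)

text \<open>Induction on the number of cheaper edges: a rejected edge is bypassed by a walk of
  cheaper edges, each of which is already replaced by accepted ones.\<close>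

lemma adj_rtrancl_kruskal:
  assumes fin: "\<And>t. finite {e \<in> A. c e \<le> t}"
    and uv: "(u, v) \<in> (adj {e \<in> A. c e < t})\<^sup>*"
  shows "(u, v) \<in> (adj {e \<in> A - reject c A. c e < t})\<^sup>*"
proof -
  have edge: "(i, j) \<in> (adj {f \<in> A - reject c A. c f \<le> c (i, j, m)})\<^sup>*" if "(i, j, m) \<in> A" for i j m
    using that
  proof (induction "card {f \<in> A. c f < c (i, j, m)}" arbitrary: i j m rule: less_induct)
    case less
    show ?case
    proof (cases "(i, j, m) \<in> reject c A")
      case False
      then show ?thesis using less.prems by (auto simp: adj_def intro!: r_into_rtrancl)
    next
      case True
      then have "(i, j) \<in> (adj {f \<in> A. c f < c (i, j, m)})\<^sup>*"
        by (simp add: reject_def)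
      then show ?thesis
      proof (rule adj_rtrancl_subset[rotated])
        fix a b l
        assume abl: "(a, b, l) \<in> {f \<in> A. c f < c (i, j, m)}"
        have "{f \<in> A. c f < c (a, b, l)} \<subset> {f \<in> A. c f < c (i, j, m)}"
          using abl by auto
        moreover have "finite {f \<in> A. c f < c (i, j, m)}"
          by (rule finite_subset[OF _ fin[of "c (i, j, m)"]]) auto
        ultimately have "card {f \<in> A. c f < c (a, b, l)} < card {f \<in> A. c f < c (i, j, m)}"
          by (rule psubset_card_mono[rotated])
        then have "(a, b) \<in> (adj {f \<in> A - reject c A. c f \<le> c (a, b, l)})\<^sup>*"
          using abl by (intro less.hyps) auto
        then show "(a, b) \<in> (adj {f \<in> A - reject c A. c f \<le> c (i, j, m)})\<^sup>*"
          by (rule adj_rtrancl_mono[rotated]) (use abl in auto)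
      qed
    qed
  qed
  show ?thesis
    using uv
  proof (rule adj_rtrancl_subset[rotated])
    fix a b l
    assume abl: "(a, b, l) \<in> {e \<in> A. c e < t}"
    then have "(a, b) \<in> (adj {f \<in> A - reject c A. c f \<le> c (a, b, l)})\<^sup>*"
      using edge by simp
    then show "(a, b) \<in> (adj {e \<in> A - reject c A. c e < t})\<^sup>*"
      by (rule adj_rtrancl_mono[rotated]) (use abl in auto)
  qed
qed

text \<open>The almost sure properties of the costs under which everything combinatorial is
  deterministic. Since \<open>edges n\<close> can be infinite, \<open>fin\<close> (local finiteness)
  provides the finiteness that minima and inductions need.\<close>

locale generic_costs =
  fixes n :: nat and c :: "edge \<Rightarrow> real"
  assumes inj: "inj_on c (edges n)"
    and pos: "e \<in> edges n \<Longrightarrow> 0 < c e"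
    and fin: "finite {e \<in> edges n. c e \<le> t}"
begin

text \<open>Infinitely many parallel edges leave a star around vertex 0 that avoids the finite set
  \<open>R\<close>. A tree no heavier than this star uses only edges of cost at most its weight, so
  there are finitely many competitors.\<close>

lemma ex_MST:
  assumes "finite R"
  shows "\<exists>F. is_MST n c (edges n - R) F"
proof -
  let ?A = "edges n - R"
  have "\<exists>m. (0, j, m) \<notin> R" for j
  proof (rule ccontr)
    assume "\<not> ?thesis"
    then have "range (\<lambda>m. (0, j, m)) \<subseteq> R" by auto
    then have "finite (range (\<lambda>m::nat. (0::nat, j, m)))"
      using assms finite_subset by blast
    then show False
      using finite_imageD[of "\<lambda>m::nat. (0::nat, j, m)" UNIV] by (auto simp: inj_on_def)
  qed
  then obtain m where m: "(0, j, m j) \<notin> R" for j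
    by metis
  define S :: "edge set" where "S = (\<lambda>j. (0, j, m j)) ` {1..<n}"
  have 0: "(0, v) \<in> (adj S)\<^sup>*" if "v < n" for v
  proof (cases "v = 0")
    case False
    then have "(0, v, m v) \<in> S"
      using that by (auto simp: S_def)
    then have "(0, v) \<in> adj S"
      by (auto simp: adj_def)
    then show ?thesis ..
  qed simp
  have "connected_on n S"
    unfolding connected_on_def using 0 adj_rtrancl_sym by (meson rtrancl_trans)
  moreover have "S \<subseteq> ?A"
    using m by (auto simp: S_def edges_def)
  moreover have "card S = n - 1"
    unfolding S_def by (subst card_image) (auto simp: inj_on_def)
  ultimately have S: "spanning_tree n ?A S"
    by (auto simp: spanning_tree_def S_def)
  define \<F> where "\<F> = {F. spanning_tree n ?A F \<and> weight c F \<le> weight c S}"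
  have "\<F> \<subseteq> Pow {e \<in> edges n. c e \<le> weight c S}"
  proof
    fix F
    assume F: "F \<in> \<F>"
    have "c e \<le> weight c S" if "e \<in> F" for e
    proof -
      have "c e \<le> weight c F"
        unfolding weight_def by (rule member_le_sum)
          (use F that pos less_imp_le in \<open>auto simp: \<F>_def spanning_tree_def, blast\<close>)
      then show ?thesis using F by (auto simp: \<F>_def)
    qed
    then show "F \<in> Pow {e \<in> edges n. c e \<le> weight c S}"
      using F by (auto simp: \<F>_def spanning_tree_def)
  qed
  then have "finite \<F>"
    using fin finite_subset by blast
  moreover have "S \<in> \<F>"
    using S by (simp add: \<F>_def)
  ultimately obtain F where F: "F \<in> \<F>" "\<And>F'. F' \<in> \<F> \<Longrightarrow> weight c F \<le> weight c F'"
    using arg_min_if_finite[of \<F> "weight c"] by (metis empty_iff linorder_not_less)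
  have "weight c F \<le> weight c F'" if "spanning_tree n ?A F'" for F'
  proof (cases "F' \<in> \<F>")
    case False
    then have "weight c S < weight c F'"
      using that by (auto simp: \<F>_def)
    then show ?thesis
      using F(2)[OF \<open>S \<in> \<F>\<close>] by simp
  qed (use F in simp)
  then show ?thesis
    using F(1) by (auto simp: is_MST_def \<F>_def)
qed

text \<open>Both inclusions are exchange arguments: a rejected tree edge could be replaced by a
  cheaper edge, and an accepted edge outside the tree could replace a costlier tree edge.\<close>

lemma is_MST_eq_kruskal:
  assumes "is_MST n c A F" "A \<subseteq> edges n"
  shows "F = A - reject c A"
proof
  have tree: "spanning_tree n A F" and F: "F \<subseteq> A" "finite F" "connected_on n F"
    using assms(1) by (auto simp: is_MST_def spanning_tree_def)
  have "(i, j, m) \<notin> reject c A" if e: "(i, j, m) \<in> F" for i j m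
  proof
    assume "(i, j, m) \<in> reject c A"
    then have con: "(i, j) \<in> (adj {e \<in> A. c e < c (i, j, m)})\<^sup>*"
      by (simp add: reject_def)
    let ?Q = "(adj (F - {(i, j, m)}))\<^sup>*"
    have nQ: "(i, j) \<notin> ?Q"
      using spanning_tree_bridge[OF tree e] .
    \<comment> \<open>Deleting \<open>(i, j, m)\<close> cuts the tree in two. The walk of cheaper
      edges from \<open>i\<close> to \<open>j\<close> must leave the part of \<open>i\<close>, and
      the edge \<open>f\<close> on which it does so reconnects the parts.\<close>
    obtain a b where ab: "(a, b) \<in> adj {e \<in> A. c e < c (i, j, m)}" "(i, a) \<in> ?Q" "(i, b) \<notin> ?Q"
      using rtrancl_crossing[where P = "\<lambda>x. (i, x) \<in> ?Q", OF con rtrancl_refl nQ] .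
    then obtain f l where f: "f \<in> A" "c f < c (i, j, m)" "f = (a, b, l) \<or> f = (b, a, l)"
      by (auto simp: adj_def)
    have "(a, b) \<notin> ?Q"
      using ab(3) rtrancl_trans[OF ab(2)] by (rule contrapos_nn)
    moreover have "(a, b) \<in> ?Q" if "f \<in> F - {(i, j, m)}"
      by (rule adj_rtranclI[of _ _ l]) (use f(3) that in blast)
    ultimately have "f \<notin> F - {(i, j, m)}"
      by (rule contrapos_nn)
    then have fF: "f \<notin> F"
      using f(2) by auto
    have "b < n" "i < n"
      using f assms(2) e F by (auto simp: edges_def)
    then have "(b, i) \<in> (adj F)\<^sup>*"
      using F(3) by (auto simp: connected_on_def)
    then have "(b, i) \<in> (adj (insert (i, j, m) (F - {(i, j, m)})))\<^sup>*"
      using e by (simp add: insert_absorb)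
    \<comment> \<open>The tree joins \<open>b\<close> to \<open>i\<close> only through the deleted
      edge, so \<open>b\<close> lies in the part of \<open>j\<close>.\<close>
    from adj_rtrancl_insertD[OF this] have "(b, j) \<in> ?Q"
      using ab(3) adj_rtrancl_sym[of b i "F - {(i, j, m)}"] by argo
    let ?Q' = "(adj (insert f (F - {(i, j, m)})))\<^sup>*"
    have "(i, a) \<in> ?Q'" "(b, j) \<in> ?Q'"
      by (rule adj_rtrancl_mono[OF subset_insertI], fact)+
    moreover have "(a, b) \<in> ?Q'"
      by (rule adj_rtranclI[of _ _ l]) (use f(3) in blast)
    ultimately have "(i, j) \<in> ?Q'"
      by (meson rtrancl_trans)
    then have "c (i, j, m) \<le> c f"
      by (rule is_MST_exchange[OF assms(1) e, rotated]) (use f(1) fF in simp)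
    then show False
      using f(2) by simp
  qed
  then show "F \<subseteq> A - reject c A"
    using F(1) by auto
  show "A - reject c A \<subseteq> F"
  proof (rule ccontr)
    assume "\<not> A - reject c A \<subseteq> F"
    then obtain i j m where e: "(i, j, m) \<in> A" "(i, j, m) \<notin> reject c A" "(i, j, m) \<notin> F"
      by auto
    then have "i < n" "j < n"
      using assms(2) by (auto simp: edges_def)
    then have "(i, j) \<in> (adj F)\<^sup>*"
      using F(3) by (auto simp: connected_on_def)
    \<comment> \<open>By minimality every edge of \<open>G\<close> separates \<open>i\<close> from
      \<open>j\<close> within \<open>G\<close>, as on a path.\<close>
    then obtain G where G: "G \<subseteq> F" "(i, j) \<in> (adj G)\<^sup>*"
        and G_min: "\<And>H. H \<subset> G \<Longrightarrow> (i, j) \<notin> (adj H)\<^sup>*"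
      using ex_minimal_subset[of F "\<lambda>G. (i, j) \<in> (adj G)\<^sup>*", OF F(2)] by metis
    \<comment> \<open>The edge was not rejected, so strictly cheaper edges do not join
      \<open>i\<close> and \<open>j\<close>, and \<open>G\<close> has an edge at least as
      expensive.\<close>
    have "\<not> G \<subseteq> {f \<in> A. c f < c (i, j, m)}"
      using e(1,2) G(2) adj_rtrancl_mono by (auto simp: reject_def)
    then obtain a b l where g: "(a, b, l) \<in> G" "c (i, j, m) \<le> c (a, b, l)"
      using G(1) F(1) by fastforce
    then have gF: "(a, b, l) \<in> F"
      using G by auto
    have neq: "c (a, b, l) \<noteq> c (i, j, m)"
    proof
      assume "c (a, b, l) = c (i, j, m)"
      then have "(a, b, l) = (i, j, m)"
        using subsetD[OF assms(2) subsetD[OF F(1) gF]] subsetD[OF assms(2) e(1)]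
        by (rule inj_onD[OF inj])
      with gF e(3) show False
        by (metis (no_types))
    qed
    let ?Q = "(adj (G - {(a, b, l)}))\<^sup>*"
    let ?Q' = "(adj (insert (i, j, m) (F - {(a, b, l)})))\<^sup>*"
    have "(i, j) \<notin> ?Q"
      by (rule G_min) (use g(1) in blast)
    moreover have "(i, j) \<in> (adj (insert (a, b, l) (G - {(a, b, l)})))\<^sup>*"
      using G(2) g(1) by (simp add: insert_absorb)
    ultimately have "(i, a) \<in> ?Q \<and> (b, j) \<in> ?Q \<or> (i, b) \<in> ?Q \<and> (a, j) \<in> ?Q"
      using adj_rtrancl_insertD[of i j a b l "G - {(a, b, l)}"] by argo
    moreover have "G - {(a, b, l)} \<subseteq> insert (i, j, m) (F - {(a, b, l)})"
      using G(1) by blast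
    note sub = adj_rtrancl_mono[OF this]
    have ij: "(i, j) \<in> ?Q'"
      by (rule adj_rtranclI[of _ _ m]) simp
    have "(a, b) \<in> ?Q'" if "(i, a) \<in> ?Q'" "(b, j) \<in> ?Q'" for a b
      using rtrancl_trans[OF adj_rtrancl_sym[OF that(1)] rtrancl_trans[OF ij adj_rtrancl_sym[OF that(2)]]] .
    from this[OF sub sub, of a b] this[OF sub sub, THEN adj_rtrancl_sym, of b a] calculation(1)
    have "(a, b) \<in> ?Q'"
      by argo
    then have "c (a, b, l) \<le> c (i, j, m)"
      by (rule is_MST_exchange[OF assms(1) gF, rotated]) (use e in simp)
    then show False
      using g(2) neq by simp
  qed
qed

text \<open>The value of \<open>SOME\<close> is pinned down by Kruskal's rule; from here on no
  choice is involved.\<close>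

lemma next_mst:
  assumes "finite R"
  shows "next_mst n c R = (edges n - R) - reject c (edges n - R)"
    and "spanning_tree n (edges n - R) (next_mst n c R)"
proof -
  have "is_MST n c (edges n - R) (next_mst n c R)"
    unfolding next_mst_def using ex_MST[OF assms] by (rule someI_ex)
  then show "next_mst n c R = (edges n - R) - reject c (edges n - R)"
    and "spanning_tree n (edges n - R) (next_mst n c R)"
    using is_MST_eq_kruskal by (auto simp: is_MST_def)
qed

end

section \<open>Successive layers, separation and causality\<close>

text \<open>The edges left over after \<open>k\<close> rounds, as an explicit function of the costs.
  It makes sense for all costs, which is what measurability and causality need.\<close>

primrec residual :: "nat \<Rightarrow> (edge \<Rightarrow> real) \<Rightarrow> nat \<Rightarrow> edge set" where
  "residual n c 0 = edges n"
| "residual n c (Suc k) = reject c (residual n c k)"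

lemma residual_subset: "residual n c k \<subseteq> edges n"
  by (induction k) (use reject_subset in auto)

text \<open>The \<open>k\<close>-th layer is the paper's \<open>T\<^bsub>k+1\<^esub>\<close>.\<close>

definition layer :: "nat \<Rightarrow> (edge \<Rightarrow> real) \<Rightarrow> nat \<Rightarrow> edge set" where
  "layer n c k = residual n c k - residual n c (Suc k)"

text \<open>The predicate written as \<open>D\<close> in the overview, with the index shifted:
  \<open>k\<close> trees have been removed, so it governs the tree number
  \<open>k + 1\<close>.\<close>

definition separated :: "nat \<Rightarrow> (edge \<Rightarrow> real) \<Rightarrow> nat \<Rightarrow> real \<Rightarrow> nat \<Rightarrow> nat \<Rightarrow> bool" where
  "separated n c k t u v \<longleftrightarrow> (u, v) \<notin> (adj {e \<in> residual n c k. c e < t})\<^sup>*"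

lemma separated_sym: "separated n c k t u v \<longleftrightarrow> separated n c k t v u"
  unfolding separated_def using adj_rtrancl_sym by blast

text \<open>An edge surviving round \<open>k\<close> has its ends joined by cheaper leftover edges.
  One whose ends are separated has therefore been accepted by then, namely in the first round
  \<open>l\<close> that does not pass it on.\<close>

lemma separated_own_cost:
  assumes "(i, j, m) \<in> edges n" "separated n c k (c (i, j, m)) i j"
  shows "\<exists>l\<le>k. (i, j, m) \<in> layer n c l"
proof -
  have "(i, j, m) \<notin> residual n c (Suc k)"
    using assms(2) by (auto simp: separated_def reject_def)
  define l where "l = (LEAST l. (i, j, m) \<notin> residual n c (Suc l))"
  have "(i, j, m) \<notin> residual n c (Suc l)" "l \<le> k"
    unfolding l_def using \<open>(i, j, m) \<notin> residual n c (Suc k)\<close> by (rule LeastI, rule Least_le)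
  moreover have "(i, j, m) \<in> residual n c l"
  proof (cases l)
    case 0
    then show ?thesis using assms(1) by simp
  next
    case (Suc l')
    then show ?thesis
      using not_less_Least[of l' "\<lambda>l. (i, j, m) \<notin> residual n c (Suc l)"] l_def by auto
  qed
  ultimately show ?thesis
    unfolding layer_def by blast
qed

text \<open>Rejection of an edge looks only at strictly cheaper edges, so induction on
  \<open>k\<close> never leaves the costs below \<open>t\<close>. The disjunction in the hypothesis
  prevents an edge from being cheap under only one of the two cost functions.\<close>

lemma residual_causal:
  assumes "\<And>e. e \<in> edges n \<Longrightarrow> c e < t \<or> c' e < t \<Longrightarrow> c e = c' e"
  shows "{e \<in> residual n c k. c e < t} = {e \<in> residual n c' k. c' e < t}"
proof (induction k)
  case 0
  have "c e < t \<longleftrightarrow> c' e < t" if "e \<in> edges n" for e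
    using assms[OF that] by argo
  then show ?case
    unfolding residual.simps by (intro Collect_cong conj_cong refl)
next
  case (Suc k)
  have *: "e \<in> residual n c k \<longleftrightarrow> e \<in> residual n c' k" "c e = c' e"
    if "e \<in> edges n" "c e < t \<or> c' e < t" for e
  proof -
    show "c e = c' e"
      using assms[OF that] .
    then show "e \<in> residual n c k \<longleftrightarrow> e \<in> residual n c' k"
      using eqset_imp_iff[OF Suc, of e] that(2) unfolding mem_Collect_eq by argo
  qed
  have below: "{e \<in> residual n c k. c e < s} = {e \<in> residual n c' k. c' e < s}" if "s \<le> t" for s
  proof (rule set_eqI)
    fix e
    show "e \<in> {e \<in> residual n c k. c e < s} \<longleftrightarrow> e \<in> {e \<in> residual n c' k. c' e < s}"
      using *[of e] subsetD[OF residual_subset, of e n c k] subsetD[OF residual_subset, of e n c' k] that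
      unfolding mem_Collect_eq by argo
  qed
  have eq: "(i, j, m) \<in> residual n c (Suc k) \<longleftrightarrow> (i, j, m) \<in> residual n c' (Suc k)"
    if "(i, j, m) \<in> edges n" "c (i, j, m) < t \<or> c' (i, j, m) < t" for i j m
  proof -
    have "c (i, j, m) = c' (i, j, m)" "c (i, j, m) \<le> t"
      using *(2)[OF that] that(2) by auto
    with below[of "c (i, j, m)"] *(1)[OF that] show ?thesis
      by (simp add: reject_def)
  qed
  show ?case
  proof (rule set_eqI)
    fix e :: edge
    obtain i j m where e: "e = (i, j, m)"
      by (cases e)
    show "e \<in> {e \<in> residual n c (Suc k). c e < t} \<longleftrightarrow> e \<in> {e \<in> residual n c' (Suc k). c' e < t}"
    proof (cases "e \<in> edges n \<and> (c e < t \<or> c' e < t)")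
      case True
      then show ?thesis
        using eq[of i j m] *(2)[of e] True unfolding e mem_Collect_eq by argo
    next
      case False
      then show ?thesis
        using subsetD[OF residual_subset, of e n c "Suc k"] subsetD[OF residual_subset, of e n c' "Suc k"] False
        unfolding mem_Collect_eq by argo
    qed
  qed
qed

lemma separated_causal:
  assumes "\<And>e. e \<in> edges n \<Longrightarrow> c e < t \<or> c' e < t \<Longrightarrow> c e = c' e"
  shows "separated n c k t u v \<longleftrightarrow> separated n c' k t u v"
  unfolding separated_def using residual_causal[OF assms] by simp

context generic_costs
begin

text \<open>The bridge from the trees chosen by \<open>SOME\<close> to the explicit
  recursion.\<close>

lemma used_residual: "finite (used n c k) \<and> residual n c k = edges n - used n c k"
proof (induction k)
  case (Suc k)
  then have fin: "finite (used n c k)" and res: "residual n c k = edges n - used n c k"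
    by auto
  have "finite (next_mst n c (used n c k))"
    using next_mst(2)[OF fin] by (simp add: spanning_tree_def)
  then show ?case
    using fin reject_subset[of c "residual n c k"]
    unfolding residual.simps used.simps next_mst(1)[OF fin] res by blast
qed simp

lemma kth_mst_eq_layer: "kth_mst n c (Suc k) = layer n c k"
  using next_mst(1)[of "used n c k"] used_residual[of k] by (simp add: kth_mst_def layer_def)

lemma finite_layer: "finite (layer n c k)" and card_layer: "card (layer n c k) = n - 1"
  using next_mst(2)[of "used n c k"] used_residual[of k] kth_mst_eq_layer[of k]
  by (simp_all add: kth_mst_def spanning_tree_def)

lemma layer_subset: "layer n c k \<subseteq> edges n"
  using residual_subset by (auto simp: layer_def)

lemma card_layer_ge_le:
  assumes "v < n"
  shows "card {e \<in> layer n c k. t \<le> c e} \<le> card {u. u < n \<and> separated n c k t v u}"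
proof -
  let ?F = "{e \<in> layer n c k. c e < t}"
  have con: "(v, u) \<in> (adj ?F)\<^sup>*" if "\<not> separated n c k t v u" for u
  proof -
    have "(v, u) \<in> (adj {e \<in> residual n c k. c e < t})\<^sup>*"
      using that by (simp add: separated_def)
    moreover have "finite {e \<in> residual n c k. c e \<le> s}" for s
      by (rule finite_subset[OF _ fin[of s]]) (use residual_subset in auto)
    ultimately show ?thesis
      using adj_rtrancl_kruskal by (simp add: layer_def)
  qed
  have "{..<n} \<subseteq> {u. u < n \<and> separated n c k t v u} \<union> {u. (v, u) \<in> (adj ?F)\<^sup>*}"
    using con by auto
  moreover have "finite ({u. u < n \<and> separated n c k t v u} \<union> {u. (v, u) \<in> (adj ?F)\<^sup>*})"
    using card_reachable_le(1)[of ?F v] finite_layer by simp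
  ultimately have "card {..<n} \<le> card ({u. u < n \<and> separated n c k t v u} \<union> {u. (v, u) \<in> (adj ?F)\<^sup>*})"
    by (intro card_mono)
  also have "\<dots> \<le> card {u. u < n \<and> separated n c k t v u} + card {u. (v, u) \<in> (adj ?F)\<^sup>*}"
    by (rule card_Un_le)
  also have "card {u. (v, u) \<in> (adj ?F)\<^sup>*} \<le> card ?F + 1"
    using finite_layer by (intro card_reachable_le) auto
  finally have "n \<le> card {u. u < n \<and> separated n c k t v u} + (card ?F + 1)"
    by simp
  moreover have "card ?F + card {e \<in> layer n c k. t \<le> c e} = card (layer n c k)"
    using finite_layer by (subst card_Un_disjoint[symmetric]) (auto intro!: arg_cong[where f = card])
  \<comment> \<open>The layer has \<open>n - 1\<close> edges in all, which cancels the extra vertex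
    in the size of the component of \<open>v\<close>.\<close>
  ultimately show ?thesis
    using card_layer assms by simp
qed

end

definition pairs :: "nat \<Rightarrow> (nat \<times> nat) set" where
  "pairs n = {(i, j). i < j \<and> j < n}"

lemma finite_pairs [simp]: "finite (pairs n)"
  by (rule finite_subset[of _ "{..<n} \<times> {..<n}"]) (auto simp: pairs_def)

text \<open>The left side counts ordered pairs; separation is symmetric and never holds on the
  diagonal.\<close>

lemma card_separated:
  "(\<Sum>v<n. card {u. u < n \<and> separated n c k t v u})
    = 2 * card {(i, j). (i, j) \<in> pairs n \<and> separated n c k t i j}" (is "?L = 2 * card ?P")
proof -
  have "?L = card (SIGMA v:{..<n}. {u. u < n \<and> separated n c k t v u})"
    by (subst card_SigmaI) auto
  also have "(SIGMA v:{..<n}. {u. u < n \<and> separated n c k t v u}) = ?P \<union> prod.swap ` ?P"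
  proof -
    have "\<not> separated n c k t v v" for v
      by (simp add: separated_def)
    then have ne: "separated n c k t v u \<Longrightarrow> v < u \<or> u < v" for u v
      by (cases v u rule: linorder_cases) auto
    have "(v, u) \<in> (SIGMA v:{..<n}. {u. u < n \<and> separated n c k t v u}) \<longleftrightarrow>
      (v, u) \<in> ?P \<or> (v, u) \<in> prod.swap ` ?P" for u v
      unfolding pair_in_swap_image mem_Sigma_iff mem_Collect_eq case_prod_conv pairs_def lessThan_iff
      using ne[of v u] separated_sym[of n c k t u v] less_trans[of v u n] less_trans[of u v n] by argo
    then show ?thesis
      by (intro set_eqI) (simp add: split_paired_all del: pair_in_swap_image mem_Sigma_iff)
  qed
  also have "card \<dots> = card ?P + card (prod.swap ` ?P)"
  proof (rule card_Un_disjoint)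
    show "finite ?P"
      by (rule finite_subset[OF _ finite_pairs[of n]]) auto
    then show "finite (prod.swap ` ?P)" by simp
    show "?P \<inter> prod.swap ` ?P = {}"
      by (auto simp: pairs_def)
  qed
  also have "card (prod.swap ` ?P) = card ?P"
    by (rule card_image) auto
  finally show ?thesis by simp
qed

lemma (in generic_costs) n_card_layer_ge_le:
  "n * card {e \<in> layer n c k. t \<le> c e} \<le> 2 * card {(i, j). (i, j) \<in> pairs n \<and> separated n c k t i j}"
proof -
  have "n * card {e \<in> layer n c k. t \<le> c e} = (\<Sum>v<n. card {e \<in> layer n c k. t \<le> c e})"
    by simp
  also have "\<dots> \<le> (\<Sum>v<n. card {u. u < n \<and> separated n c k t v u})"
    by (rule sum_mono) (use card_layer_ge_le in auto)
  finally show ?thesis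
    by (simp only: card_separated)
qed

subsection \<open>Measurability and genericity of the costs\<close>

lemma sets_exp1 [measurable_cong, simp]: "sets exp1 = sets borel"
  by (simp add: exp1_def)

lemma space_exp1 [simp]: "space exp1 = UNIV"
  by (simp add: exp1_def)

lemma prob_space_exp1: "prob_space exp1"
  unfolding exp1_def by (rule prob_space_exponential_density) simp

lemma prob_space_poisson_mg: "prob_space (poisson_mg n)"
  unfolding poisson_mg_def by (rule prob_space_PiM) (rule prob_space_exp1)

lemma measurable_interarrival:
  "e \<in> edges n \<Longrightarrow> (\<lambda>X. X e) \<in> borel_measurable (poisson_mg n)"
  using measurable_component_singleton[of e "edges n" "\<lambda>_. exp1"]
  by (simp add: poisson_mg_def measurable_cong_sets[OF refl sets_exp1])

lemma measurable_cost: "e \<in> edges n \<Longrightarrow> (\<lambda>X. cost X e) \<in> borel_measurable (poisson_mg n)"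
  by (cases e) (auto simp: cost_def edges_def intro!: borel_measurable_sum measurable_interarrival)

text \<open>Reachability is a countable union over walk lengths, and each length a countable union
  over intermediate vertices and edge labels.\<close>

lemma pred_adj_rtrancl:
  assumes [measurable]: "\<And>e. Measurable.pred M (\<lambda>x. e \<in> F x)"
  shows "Measurable.pred M (\<lambda>x. (u, v) \<in> (adj (F x))\<^sup>*)"
proof -
  have "Measurable.pred M (\<lambda>x. (u, v) \<in> adj (F x) ^^ l)" for l
  proof (induction l arbitrary: v)
    case 0
    then show ?case by simp
  next
    case (Suc l)
    note [measurable] = Suc
    have "(\<lambda>x. (u, v) \<in> adj (F x) ^^ Suc l) =
        (\<lambda>x. \<exists>w. (u, w) \<in> adj (F x) ^^ l \<and> ((\<exists>m. (w, v, m) \<in> F x) \<or> (\<exists>m. (v, w, m) \<in> F x)))"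
      by (auto simp: fun_eq_iff adj_def relcomp_unfold)
    then show ?case by simp
  qed
  then have "Measurable.pred M (\<lambda>x. \<exists>l. (u, v) \<in> adj (F x) ^^ l)"
    by measurable
  then show ?thesis
    by (simp add: rtrancl_is_UN_relpow)
qed

text \<open>The sample is a measurable map \<open>X\<close> on an arbitrary space, so that the
  result serves for the model itself, for its product with a time axis and for a fixed sample. Edges
  outside \<open>edges n\<close> are treated apart because they carry no measurable cost.\<close>

lemma pred_residual:
  assumes X: "X \<in> M \<rightarrow>\<^sub>M poisson_mg n"
  shows "Measurable.pred M (\<lambda>x. e \<in> residual n (cost (X x)) k)"
proof (induction k arbitrary: e)
  case 0
  show ?case by simp
next
  case (Suc k)
  obtain i j m where e: "e = (i, j, m)"
    by (cases e)
  show ?case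
  proof (cases "(i, j, m) \<in> edges n")
    case False
    then have "(i, j, m) \<notin> residual n (cost (X x)) (Suc k)" for x
      using residual_subset by blast
    then show ?thesis
      unfolding e by simp
  next
    case True
    have "Measurable.pred M (\<lambda>x. f \<in> {f \<in> residual n (cost (X x)) k. cost (X x) f < cost (X x) (i, j, m)})" for f
    proof (cases "f \<in> edges n")
      case False
      then have "f \<notin> residual n (cost (X x)) k" for x
        using residual_subset by blast
      then show ?thesis by simp
    next
      case f: True
      note [measurable] = Suc measurable_compose[OF X measurable_cost[OF f]]
        measurable_compose[OF X measurable_cost[OF True]]
      show ?thesis
        unfolding mem_Collect_eq by measurable
    qed
    note [measurable] = Suc pred_adj_rtrancl[OF this]
    show ?thesis
      unfolding e residual.simps reject_def mem_Collect_eq case_prod_conv by measurable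
  qed
qed

lemma pred_layer:
  assumes X: "X \<in> M \<rightarrow>\<^sub>M poisson_mg n"
  shows "Measurable.pred M (\<lambda>x. e \<in> layer n (cost (X x)) k)"
proof -
  note [measurable] = pred_residual[OF X]
  show ?thesis
    unfolding layer_def Diff_iff by measurable
qed

lemma pred_separated:
  assumes X: "X \<in> M \<rightarrow>\<^sub>M poisson_mg n" and [measurable]: "t \<in> borel_measurable M"
  shows "Measurable.pred M (\<lambda>x. separated n (cost (X x)) k (t x) u v)"
proof -
  have "Measurable.pred M (\<lambda>x. f \<in> {f \<in> residual n (cost (X x)) k. cost (X x) f < t x})" for f
  proof (cases "f \<in> edges n")
    case False
    then have "f \<notin> residual n (cost (X x)) k" for x
      using residual_subset by blast
    then show ?thesis by simp
  next
    case f: True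
    note [measurable] = pred_residual[OF X] measurable_compose[OF X measurable_cost[OF f]]
    show ?thesis
      unfolding mem_Collect_eq by measurable
  qed
  note [measurable] = pred_adj_rtrancl[OF this]
  show ?thesis
    unfolding separated_def by measurable
qed

lemma measurable_resample:
  assumes "e \<in> edges n"
  shows "(\<lambda>(x, Z). Z(e := x)) \<in> exp1 \<Otimes>\<^sub>M poisson_mg n \<rightarrow>\<^sub>M poisson_mg n"
proof -
  have "(\<lambda>w. (snd w)(e := fst w)) \<in> exp1 \<Otimes>\<^sub>M poisson_mg n \<rightarrow>\<^sub>M (PiM (edges n) (\<lambda>_. exp1))"
    by (rule measurable_fun_upd[where J = "edges n"])
      (use assms in \<open>auto simp: poisson_mg_def\<close>)
  then show ?thesis
    by (simp add: poisson_mg_def case_prod_unfold)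
qed

lemma measurable_resample_fixed:
  assumes "e \<in> edges n" "Z \<in> space (poisson_mg n)"
  shows "(\<lambda>x. Z(e := x)) \<in> borel \<rightarrow>\<^sub>M poisson_mg n"
proof -
  have "(\<lambda>x. Z(e := x)) \<in> exp1 \<rightarrow>\<^sub>M poisson_mg n"
    using measurable_compose[OF measurable_Pair2'[OF assms(2)] measurable_resample[OF assms(1)]] by simp
  then show ?thesis
    by (simp add: measurable_cong_sets[OF sets_exp1 refl])
qed

text \<open>An independent fresh value in one coordinate leaves the product law unchanged. This
  allows integrating over one gap first while all other gaps are fixed.\<close>

lemma nn_integral_resample:
  assumes "e \<in> edges n" and f: "f \<in> borel_measurable (poisson_mg n)"
  shows "(\<integral>\<^sup>+X. f X \<partial>poisson_mg n) = (\<integral>\<^sup>+Z. \<integral>\<^sup>+x. f (Z(e := x)) \<partial>exp1 \<partial>poisson_mg n)"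
proof -
  interpret E: prob_space exp1 by (rule prob_space_exp1)
  interpret P: prob_space "poisson_mg n" by (rule prob_space_poisson_mg)
  interpret pair_sigma_finite exp1 "poisson_mg n" ..
  note [measurable] = measurable_resample[OF assms(1)] f
  have "poisson_mg n = distr (exp1 \<Otimes>\<^sub>M poisson_mg n) (poisson_mg n) (\<lambda>(x, Z). Z(e := x))"
    using distr_pair_PiM_eq_PiM[of "edges n" "\<lambda>_. exp1" e] prob_space_exp1
    by (simp add: poisson_mg_def insert_absorb[OF assms(1)])
  then have "(\<integral>\<^sup>+X. f X \<partial>poisson_mg n) =
      (\<integral>\<^sup>+X. f X \<partial>distr (exp1 \<Otimes>\<^sub>M poisson_mg n) (poisson_mg n) (\<lambda>(x, Z). Z(e := x)))"
    by simp
  also have "\<dots> = (\<integral>\<^sup>+w. f ((\<lambda>(x, Z). Z(e := x)) w) \<partial>(exp1 \<Otimes>\<^sub>M poisson_mg n))"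
    by (rule nn_integral_distr) measurable
  also have "\<dots> = (\<integral>\<^sup>+Z. \<integral>\<^sup>+x. f (Z(e := x)) \<partial>exp1 \<partial>poisson_mg n)"
    using nn_integral_snd[of "\<lambda>w. f ((\<lambda>(x, Z). Z(e := x)) w)"] by simp
  finally show ?thesis .
qed

section \<open>Almost sure properties of the costs\<close>

lemma AE_interarrival_pos: "AE X in poisson_mg n. \<forall>e\<in>edges n. 0 < X e"
proof -
  have "AE x in exp1. 0 < x"
  proof -
    have "AE x in lborel. x \<noteq> (0::real)"
      by (rule AE_lborel_singleton)
    then show ?thesis
      unfolding exp1_def by (subst AE_density) (auto simp: exponential_density_def elim!: eventually_mono)
  qed
  then have "AE X in poisson_mg n. 0 < X e" if "e \<in> edges n" for e
    unfolding poisson_mg_def using that prob_space_exp1 by (intro AE_PiM_component)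
  then show ?thesis
    by (subst AE_ball_countable) auto
qed

lemma emeasure_exp1_singleton: "emeasure exp1 {x} = 0"
  unfolding exp1_def by (subst emeasure_density) (auto simp: nn_integral_0_iff_AE intro!: AE_I[of _ _ "{x}"])

lemma emeasure_exp1_greaterThan:
  assumes "0 \<le> y"
  shows "emeasure exp1 {y<..} = ennreal (exp (- y))"
proof -
  interpret E: prob_space exp1 by (rule prob_space_exp1)
  have "distributed exp1 lborel (\<lambda>x. x) (exponential_density 1)"
    unfolding distributed_def by (auto simp: exp1_def intro!: measure_eqI simp: emeasure_distr)
  from E.exponential_distributedD_gt[OF this assms] show ?thesis
    by (simp add: E.emeasure_eq_measure greaterThan_def)
qed

text \<open>Gap \<open>m\<close> of a pair influences only the points of that pair from index
  \<open>m\<close> on.\<close>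

lemma cost_fun_upd_other:
  assumes "(i', j') \<noteq> (i, j) \<or> m' < m"
  shows "cost (Z((i, j, m) := x)) (i', j', m') = cost Z (i', j', m')"
  using assms by (auto simp: cost_def intro!: sum.cong)

lemma cost_fun_upd_same:
  "cost (Z((i, j, m) := x)) (i, j, m) = (\<Sum>l<m. Z (i, j, l)) + x"
  by (simp add: cost_def lessThan_Suc_atMost[symmetric])

lemma cost_mono:
  assumes "\<And>l. 0 \<le> X (i, j, l)" "l \<le> m"
  shows "cost X (i, j, l) \<le> cost X (i, j, m)"
  unfolding cost_def prod.case by (rule sum_mono2) (use assms in auto)

text \<open>With all other gaps fixed, equality forces the last gap of \<open>(i, j, m)\<close> to
  be one particular number, which has probability zero.\<close>

lemma AE_cost_neq:
  assumes e: "(i, j, m) \<in> edges n" and e': "(i', j', m') \<in> edges n" and ne: "(i', j') \<noteq> (i, j)"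
  shows "AE X in poisson_mg n. cost X (i, j, m) \<noteq> cost X (i', j', m')"
proof -
  let ?f = "\<lambda>X. of_bool (cost X (i, j, m) = cost X (i', j', m')) :: ennreal"
  note [measurable] = measurable_cost[OF e] measurable_cost[OF e']
  have f: "?f \<in> borel_measurable (poisson_mg n)"
    by (rule measurable_compose[OF _ measurable_of_bool])
      (unfold pred_def, intro borel_measurable_eq measurable_cost e e')
  have "(\<integral>\<^sup>+X. ?f X \<partial>poisson_mg n) = (\<integral>\<^sup>+Z. \<integral>\<^sup>+x. ?f (Z((i, j, m) := x)) \<partial>exp1 \<partial>poisson_mg n)"
    by (rule nn_integral_resample[OF e f])
  also have "\<dots> = (\<integral>\<^sup>+Z. 0 \<partial>poisson_mg n)"
  proof (rule nn_integral_cong)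
    fix Z
    have "(\<integral>\<^sup>+x. ?f (Z((i, j, m) := x)) \<partial>exp1)
        = (\<integral>\<^sup>+x. indicator {cost Z (i', j', m') - (\<Sum>l<m. Z (i, j, l))} x \<partial>exp1)"
      by (rule nn_integral_cong)
        (auto simp: cost_fun_upd_same cost_fun_upd_other[OF disjI1[OF ne]] indicator_def)
    also have "\<dots> = 0"
      by (simp add: emeasure_exp1_singleton)
    finally show "(\<integral>\<^sup>+x. ?f (Z((i, j, m) := x)) \<partial>exp1) = 0" .
  qed
  finally have "AE X in poisson_mg n. ?f X = 0"
    by (simp add: nn_integral_0_iff_AE[OF f])
  then show ?thesis
    by eventually_elim auto
qed

text \<open>The Laplace transform of the exponential law at 1: up to the factor 1/2 the integrand is
  the exponential density of rate 2.\<close>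

lemma nn_integral_exp_minus: "(\<integral>\<^sup>+x. ennreal (exp (- x)) \<partial>exp1) = ennreal (1 / 2)"
proof -
  interpret D: prob_space "density lborel (exponential_density 2)"
    by (rule prob_space_exponential_density) simp
  have 1: "(\<integral>\<^sup>+x. ennreal (exponential_density 2 x) \<partial>lborel) = 1"
    using D.emeasure_space_1 by (simp add: emeasure_density)
  have "(\<integral>\<^sup>+x. ennreal (exp (- x)) \<partial>exp1) = (\<integral>\<^sup>+x. ennreal (exponential_density 1 x) * ennreal (exp (- x)) \<partial>lborel)"
    unfolding exp1_def by (rule nn_integral_density) auto
  also have "\<dots> = (\<integral>\<^sup>+x. ennreal (1 / 2) * ennreal (exponential_density 2 x) \<partial>lborel)"
  proof (rule nn_integral_cong)
    fix x :: real
    have "exponential_density 1 x * exp (- x) = 1 / 2 * exponential_density 2 x"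
      by (simp add: exponential_density_def exp_add[symmetric] mult.commute)
    then show "ennreal (exponential_density 1 x) * ennreal (exp (- x))
        = ennreal (1 / 2) * ennreal (exponential_density 2 x)"
      by (metis divide_nonneg_nonneg ennreal_mult erlang_density_nonneg exp_ge_zero zero_le_numeral zero_le_one)
  qed
  also have "\<dots> = ennreal (1 / 2)"
    by (subst nn_integral_cmult) (auto simp: 1)
  finally show ?thesis .
qed

lemma nn_integral_exp_minus_cost:
  assumes "i < j" "j < n"
  shows "(\<integral>\<^sup>+X. ennreal (exp (- cost X (i, j, m))) \<partial>poisson_mg n) = ennreal ((1 / 2) ^ Suc m)"
proof (induction m)
  case 0
  interpret P: prob_space "poisson_mg n" by (rule prob_space_poisson_mg)
  have e: "(i, j, 0) \<in> edges n"
    using assms by (simp add: edges_def)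
  note [measurable] = measurable_cost[OF e]
  show ?case
    by (subst nn_integral_resample[OF e])
      (simp_all add: cost_fun_upd_same nn_integral_exp_minus P.emeasure_space_1)
next
  case (Suc m)
  have e: "(i, j, k) \<in> edges n" for k
    using assms by (simp add: edges_def)
  note [measurable] = measurable_cost[OF e]
  have "(\<integral>\<^sup>+X. ennreal (exp (- cost X (i, j, Suc m))) \<partial>poisson_mg n)
      = (\<integral>\<^sup>+Z. \<integral>\<^sup>+x. ennreal (exp (- cost (Z((i, j, Suc m) := x)) (i, j, Suc m))) \<partial>exp1 \<partial>poisson_mg n)"
    by (rule nn_integral_resample[OF e]) measurable
  also have "\<dots> = (\<integral>\<^sup>+Z. ennreal (exp (- cost Z (i, j, m))) * ennreal (1 / 2) \<partial>poisson_mg n)"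
  proof (rule nn_integral_cong)
    fix Z
    have "cost (Z((i, j, Suc m) := x)) (i, j, Suc m) = cost Z (i, j, m) + x" for x
      unfolding cost_fun_upd_same by (simp add: cost_def lessThan_Suc_atMost)
    then have "(\<integral>\<^sup>+x. ennreal (exp (- cost (Z((i, j, Suc m) := x)) (i, j, Suc m))) \<partial>exp1)
      = (\<integral>\<^sup>+x. ennreal (exp (- cost Z (i, j, m))) * ennreal (exp (- x)) \<partial>exp1)"
      by (simp add: ennreal_mult[symmetric] exp_add[symmetric])
    also have "\<dots> = ennreal (exp (- cost Z (i, j, m))) * ennreal (1 / 2)"
      by (subst nn_integral_cmult) (simp_all add: nn_integral_exp_minus measurable_cong_sets[OF sets_exp1 refl])
    finally show "(\<integral>\<^sup>+x. ennreal (exp (- cost (Z((i, j, Suc m) := x)) (i, j, Suc m))) \<partial>exp1)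
      = ennreal (exp (- cost Z (i, j, m))) * ennreal (1 / 2)" .
  qed
  also have "\<dots> = ennreal ((1 / 2) ^ Suc m) * ennreal (1 / 2)"
    by (subst nn_integral_multc) (simp_all only: Suc, measurable)
  also have "\<dots> = ennreal ((1 / 2) ^ Suc (Suc m))"
    by (subst ennreal_mult[symmetric]) auto
  finally show ?case .
qed

text \<open>The expected sum of \<open>exp (- cost)\<close> over the points of the pair is a
  geometric series with value 1. The sum is thus almost surely finite, its terms tend to 0, and the
  costs tend to infinity.\<close>

lemma AE_finite_cost_le:
  assumes "i < j" "j < n"
  shows "AE X in poisson_mg n. \<forall>t. finite {m. cost X (i, j, m) \<le> t}"
proof -
  have e: "(i, j, k) \<in> edges n" for k
    using assms by (simp add: edges_def)
  note [measurable] = measurable_cost[OF e]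
  have "(\<integral>\<^sup>+X. (\<Sum>m. ennreal (exp (- cost X (i, j, m)))) \<partial>poisson_mg n) = (\<Sum>m. ennreal ((1 / 2) ^ Suc m))"
    by (subst nn_integral_suminf) (auto simp: nn_integral_exp_minus_cost[OF assms])
  also have "\<dots> = ennreal 1"
    using power_half_series by (intro suminf_ennreal_eq) auto
  finally have "(\<integral>\<^sup>+X. (\<Sum>m. ennreal (exp (- cost X (i, j, m)))) \<partial>poisson_mg n) \<noteq> \<infinity>"
    by simp
  then have "AE X in poisson_mg n. (\<Sum>m. ennreal (exp (- cost X (i, j, m)))) \<noteq> \<infinity>"
    by (intro nn_integral_PInf_AE) auto
  then show ?thesis
  proof eventually_elim
    case (elim X)
    then have "summable (\<lambda>m. exp (- cost X (i, j, m)))"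
      by (intro summable_suminf_not_top) auto
    then have lim: "(\<lambda>m. exp (- cost X (i, j, m))) \<longlonglongrightarrow> 0"
      by (rule summable_LIMSEQ_zero)
    show ?case
    proof
      fix t
      have "\<forall>\<^sub>F m in sequentially. exp (- cost X (i, j, m)) < exp (- t)"
        using lim by (rule order_tendstoD) simp
      then obtain N where "\<And>m. N \<le> m \<Longrightarrow> t < cost X (i, j, m)"
        by (auto simp: eventually_sequentially)
      then have "{m. cost X (i, j, m) \<le> t} \<subseteq> {..<N}"
        by (auto simp: not_less[symmetric])
      then show "finite {m. cost X (i, j, m) \<le> t}"
        by (rule finite_subset) simp
    qed
  qed
qed

text \<open>Different pairs are handled by countably many null events; within one pair the points
  increase strictly because the gaps are positive.\<close>

lemma AE_generic_costs: "AE X in poisson_mg n. generic_costs n (cost X)"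
proof -
  have "AE X in poisson_mg n. \<forall>p\<in>pairs n. \<forall>t. finite {m. cost X (fst p, snd p, m) \<le> t}"
    by (subst AE_ball_countable) (auto simp: pairs_def intro!: AE_finite_cost_le)
  moreover have "AE X in poisson_mg n. \<forall>w\<in>edges n \<times> edges n.
      (fst (fst w), fst (snd (fst w))) \<noteq> (fst (snd w), fst (snd (snd w))) \<longrightarrow> cost X (fst w) \<noteq> cost X (snd w)"
  proof (subst AE_ball_countable, simp, intro ballI)
    fix w assume w: "w \<in> edges n \<times> edges n"
    obtain i j m i' j' m' where eq: "w = ((i, j, m), (i', j', m'))"
      by (metis surj_pair)
    show "AE X in poisson_mg n. (fst (fst w), fst (snd (fst w))) \<noteq> (fst (snd w), fst (snd (snd w)))
        \<longrightarrow> cost X (fst w) \<noteq> cost X (snd w)"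
    proof (cases "(i', j') = (i, j)")
      case False
      have "AE X in poisson_mg n. cost X (i, j, m) \<noteq> cost X (i', j', m')"
        using w eq False by (intro AE_cost_neq) auto
      then show ?thesis
        unfolding eq fst_conv snd_conv by eventually_elim simp
    qed (simp add: eq)
  qed
  ultimately show ?thesis
    using AE_interarrival_pos
  proof eventually_elim
    case (elim X)
    have pos: "0 < X (i, j, m)" if "i < j" "j < n" for i j m
      using elim(3) that by (auto simp: edges_def)
    show ?case
    proof
      show "0 < cost X e" if "e \<in> edges n" for e
        using that pos by (cases e) (auto simp: cost_def edges_def intro!: sum_pos)
      show "finite {e \<in> edges n. cost X e \<le> t}" for t
      proof (rule finite_subset)
        show "{e \<in> edges n. cost X e \<le> t}
            \<subseteq> (\<Union>p\<in>pairs n. (\<lambda>m. (fst p, snd p, m)) ` {m. cost X (fst p, snd p, m) \<le> t})"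
        proof
          fix e assume e: "e \<in> {e \<in> edges n. cost X e \<le> t}"
          obtain i j m where eq: "e = (i, j, m)"
            by (cases e)
          show "e \<in> (\<Union>p\<in>pairs n. (\<lambda>m. (fst p, snd p, m)) ` {m. cost X (fst p, snd p, m) \<le> t})"
            by (rule UN_I[of "(i, j)"]) (use e in \<open>auto simp: eq edges_def pairs_def\<close>)
        qed
        show "finite (\<Union>p\<in>pairs n. (\<lambda>m. (fst p, snd p, m)) ` {m. cost X (fst p, snd p, m) \<le> t})"
          using elim(1) by simp
      qed
      show "inj_on (cost X) (edges n)"
      proof (rule inj_onI)
        fix e f :: edge
        assume ef: "e \<in> edges n" "f \<in> edges n" "cost X e = cost X f"
        obtain i j m i' j' m' where eq: "e = (i, j, m)" "f = (i', j', m')"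
          by (metis surj_pair)
        have "(i', j') = (i, j)"
          using elim(2)[rule_format, of "(e, f)"] ef by (auto simp: eq)
        moreover have less: "cost X (i, j, a) < cost X (i, j, b)" if "a < b" for a b
          unfolding cost_def prod.case
          by (rule sum_strict_mono2[of _ _ b]) (use that pos ef in \<open>auto simp: eq edges_def intro: less_imp_le\<close>)
        moreover have "m = m'"
          using less[of m m'] less[of m' m] ef(3) calculation(1) by (cases m m' rule: linorder_cases) (auto simp: eq)
        ultimately show "e = f"
          by (simp add: eq)
      qed
    qed
  qed
qed

subsection \<open>Memorylessness and the moment bounds\<close>

lemma measurable_separated_kernel:
  assumes "X \<in> M \<rightarrow>\<^sub>M poisson_mg n" "t \<in> borel_measurable M"
  shows "(\<lambda>x. of_bool (separated n (cost (X x)) k (t x) u v) :: ennreal) \<in> borel_measurable M"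
  by (rule measurable_compose[OF pred_separated[OF assms] measurable_of_bool])

text \<open>Memorylessness in integrated form: by Fubini the left side integrates \<open>g\<close>
  against the tail \<open>exp (- y)\<close>, and for rate 1 the tail equals the density.\<close>

lemma nn_integral_exp1_eq_tail:
  assumes [measurable]: "g \<in> borel_measurable borel"
  shows "(\<integral>\<^sup>+x. \<integral>\<^sup>+y. g y * of_bool (0 \<le> y \<and> y < x) \<partial>lborel \<partial>exp1) = (\<integral>\<^sup>+y. g y \<partial>exp1)"
proof -
  interpret E: prob_space exp1 by (rule prob_space_exp1)
  interpret pair_sigma_finite exp1 lborel ..
  have [measurable]: "(\<lambda>w. g (snd w) * of_bool (0 \<le> snd w \<and> snd w < fst w)) \<in> borel_measurable (exp1 \<Otimes>\<^sub>M lborel)"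
    by measurable
  have "(\<integral>\<^sup>+x. \<integral>\<^sup>+y. g y * of_bool (0 \<le> y \<and> y < x) \<partial>lborel \<partial>exp1)
      = (\<integral>\<^sup>+y. \<integral>\<^sup>+x. g y * of_bool (0 \<le> y \<and> y < x) \<partial>exp1 \<partial>lborel)"
    using Fubini[of "\<lambda>w. g (snd w) * of_bool (0 \<le> snd w \<and> snd w < fst w)"] by simp
  also have "\<dots> = (\<integral>\<^sup>+y. ennreal (exponential_density 1 y) * g y \<partial>lborel)"
  proof (rule nn_integral_cong)
    fix y :: real
    have "(\<integral>\<^sup>+x. g y * of_bool (0 \<le> y \<and> y < x) \<partial>exp1) = (\<integral>\<^sup>+x. (g y * of_bool (0 \<le> y)) * indicator {y<..} x \<partial>exp1)"
      by (rule nn_integral_cong) (auto simp: indicator_def)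
    also have "\<dots> = (g y * of_bool (0 \<le> y)) * emeasure exp1 {y<..}"
      by (rule nn_integral_cmult_indicator) simp
    also have "\<dots> = ennreal (exponential_density 1 y) * g y"
      by (auto simp: exponential_density_def emeasure_exp1_greaterThan mult.commute)
    finally show "(\<integral>\<^sup>+x. g y * of_bool (0 \<le> y \<and> y < x) \<partial>exp1) = ennreal (exponential_density 1 y) * g y" .
  qed
  also have "\<dots> = (\<integral>\<^sup>+y. g y \<partial>exp1)"
    unfolding exp1_def by (rule nn_integral_density[symmetric]) auto
  finally show ?thesis .
qed

text \<open>Being separated at time \<open>t\<close> depends only on the points before \<open>t\<close>, so up to time
  \<open>b + y\<close> it does not matter whether the next point comes exactly then or later.\<close>

lemma separated_resample:
  fixes l :: nat
  assumes ij: "i < j" "j < n" and pos: "\<And>e. e \<in> edges n \<Longrightarrow> 0 < Z e" and xy: "0 \<le> y" "y < x"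
  defines "e \<equiv> (i, j, l)"
  shows "separated n (cost (Z(e := x))) k (cost (Z(e := y)) e) u v
    \<longleftrightarrow> separated n (cost (Z(e := y))) k (cost (Z(e := y)) e) u v"
proof (rule separated_causal)
  fix f
  assume f: "f \<in> edges n" "cost (Z(e := x)) f < cost (Z(e := y)) e \<or> cost (Z(e := y)) f < cost (Z(e := y)) e"
  obtain i' j' m where eq: "f = (i', j', m)"
    by (cases f)
  have late: "cost (Z(e := w)) e \<le> cost (Z(e := w)) (i, j, m)" if "l \<le> m" "0 \<le> w" for w
    unfolding e_def by (rule cost_mono)
      (use pos that ij in \<open>auto simp: edges_def intro: less_imp_le\<close>)
  have "cost (Z(e := y)) e < cost (Z(e := x)) e"
    unfolding e_def cost_fun_upd_same using xy by simp
  \<comment> \<open>An edge earlier than the time in question, under either gap, cannot be a point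
    of this pair with index \<open>l\<close> or more, so its cost ignores the gap.\<close>
  then have "(i', j') \<noteq> (i, j) \<or> m < l"
    using f(2) late[of x] late[of y] xy unfolding eq by (cases "l \<le> m") auto
  then show "cost (Z(e := x)) f = cost (Z(e := y)) f"
    unfolding eq e_def by (simp only: cost_fun_upd_other)
qed

text \<open>The expected time spent separated during gap \<open>l\<close> equals the probability
  that the point ending this gap finds its ends separated (both restricted to times from
  \<open>s\<close> on). With the other gaps fixed, causality writes the time as an integral of
  \<open>g\<close> over the gap, and \<open>nn_integral_exp1_eq_tail\<close> applies.\<close>

lemma nn_integral_separated_interarrival:
  assumes ij: "i < j" "j < n"
  shows "(\<integral>\<^sup>+X. \<integral>\<^sup>+t. of_bool (s \<le> t \<and> (\<Sum>m<l. X (i, j, m)) \<le> t \<and> t < cost X (i, j, l))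
        * of_bool (separated n (cost X) k t i j) \<partial>lborel \<partial>poisson_mg n)
    = (\<integral>\<^sup>+X. of_bool (s \<le> cost X (i, j, l)) * of_bool (separated n (cost X) k (cost X (i, j, l)) i j) \<partial>poisson_mg n)"
    (is "(\<integral>\<^sup>+X. ?A X \<partial>_) = (\<integral>\<^sup>+X. ?h X \<partial>_)")
proof -
  let ?P = "poisson_mg n"
  let ?e = "(i, j, l)"
  have e: "(i, j, m) \<in> edges n" for m
    using ij by (simp add: edges_def)
  note [measurable] = measurable_cost[OF e] measurable_interarrival[OF e]
  have A: "?A \<in> borel_measurable ?P"
  proof -
    have [measurable]: "(\<lambda>w. of_bool (separated n (cost (fst w)) k (snd w) i j) :: ennreal)
        \<in> borel_measurable (?P \<Otimes>\<^sub>M lborel)"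
      by (rule measurable_separated_kernel) measurable
    have [measurable]: "(\<lambda>w. cost (fst w) ?e) \<in> borel_measurable (?P \<Otimes>\<^sub>M lborel)"
      "(\<lambda>w. fst w (i, j, m)) \<in> borel_measurable (?P \<Otimes>\<^sub>M lborel)" for m
      by (rule measurable_compose[OF measurable_fst]; measurable)+
    have "(\<lambda>w. of_bool (s \<le> snd w \<and> (\<Sum>m<l. fst w (i, j, m)) \<le> snd w \<and> snd w < cost (fst w) ?e)
        * of_bool (separated n (cost (fst w)) k (snd w) i j) :: ennreal) \<in> borel_measurable (?P \<Otimes>\<^sub>M lborel)"
      by measurable
    from lborel.borel_measurable_nn_integral_fst[OF this] show ?thesis
      by simp
  qed
  have h: "?h \<in> borel_measurable ?P"
  proof -
    have [measurable]: "(\<lambda>X. of_bool (separated n (cost X) k (cost X ?e) i j) :: ennreal) \<in> borel_measurable ?P"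
      by (rule measurable_separated_kernel) measurable
    show ?thesis by measurable
  qed
  have "(\<integral>\<^sup>+X. ?A X \<partial>?P) = (\<integral>\<^sup>+Z. \<integral>\<^sup>+x. ?A (Z(?e := x)) \<partial>exp1 \<partial>?P)"
    by (rule nn_integral_resample[OF e A])
  also have "\<dots> = (\<integral>\<^sup>+Z. \<integral>\<^sup>+x. ?h (Z(?e := x)) \<partial>exp1 \<partial>?P)"
  proof (rule nn_integral_cong_AE, use AE_interarrival_pos AE_space in eventually_elim)
    case (elim Z)
    \<comment> \<open>The gap starts at \<open>b\<close>, and \<open>g y\<close> is the right-hand
      integrand if its length were \<open>y\<close>.\<close>
    define b where "b = (\<Sum>m<l. Z (i, j, m))"
    define g where "g y = ?h (Z(?e := y))" for y
    have [measurable]: "(\<lambda>x. Z(?e := x)) \<in> borel \<rightarrow>\<^sub>M ?P"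
      by (rule measurable_resample_fixed[OF e elim(2)])
    have [measurable]: "g \<in> borel_measurable borel"
      unfolding g_def by (rule measurable_compose[OF _ h]) measurable
    have "?A (Z(?e := x)) = (\<integral>\<^sup>+y. g y * of_bool (0 \<le> y \<and> y < x) \<partial>lborel)" for x
    proof -
      have b': "(\<Sum>m<l. (Z(?e := x)) (i, j, m)) = b"
        by (simp add: b_def)
      have c: "cost (Z(?e := y)) ?e = b + y" for y
        by (simp add: cost_fun_upd_same b_def)
      have "Z(?e := x) \<in> space ?P"
        using measurable_space[OF measurable_resample_fixed[OF e elim(2)], of x] by simp
      then have "Measurable.pred borel (\<lambda>t. separated n (cost (Z(?e := x))) k t i j)"
        by (intro pred_separated[where X = "\<lambda>_. Z(?e := x)"]) simp_all
      note [measurable] = this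
      have "?A (Z(?e := x)) = (\<integral>\<^sup>+t. of_bool (s \<le> t \<and> b \<le> t \<and> t < b + x)
          * of_bool (separated n (cost (Z(?e := x))) k t i j) \<partial>lborel)"
        by (simp only: b' c)
      \<comment> \<open>Substitution \<open>t = b + y\<close>.\<close>
      also have "\<dots> = ennreal \<bar>1\<bar> * (\<integral>\<^sup>+y. of_bool (s \<le> b + 1 * y \<and> b \<le> b + 1 * y \<and> b + 1 * y < b + x)
          * of_bool (separated n (cost (Z(?e := x))) k (b + 1 * y) i j) \<partial>lborel)"
        by (rule nn_integral_real_affine[where c = 1]) simp_all
      also have "\<dots> = (\<integral>\<^sup>+y. g y * of_bool (0 \<le> y \<and> y < x) \<partial>lborel)"
      proof -
        have "of_bool (s \<le> b + y \<and> b \<le> b + y \<and> b + y < b + x)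
            * of_bool (separated n (cost (Z(?e := x))) k (b + y) i j) = g y * of_bool (0 \<le> y \<and> y < x)" for y
        proof (cases "0 \<le> y \<and> y < x")
          case True
          have "separated n (cost (Z(?e := x))) k (b + y) i j
              \<longleftrightarrow> separated n (cost (Z(?e := y))) k (b + y) i j"
            using separated_resample[OF ij, of Z y x l k i j] elim(1) True unfolding c by blast
          then show ?thesis
            using True by (simp add: g_def c)
        next
          case False
          then show ?thesis by auto
        qed
        then show ?thesis by simp
      qed
      finally show ?thesis .
    qed
    then show ?case
      using nn_integral_exp1_eq_tail[of g] by (simp add: g_def)
  qed
  also have "\<dots> = (\<integral>\<^sup>+X. ?h X \<partial>?P)"
    by (rule nn_integral_resample[OF e h, symmetric])
  finally show ?thesis .
qed

lemma term_le_suminf_ennreal: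
  fixes f :: "nat \<Rightarrow> ennreal"
  shows "f l \<le> (\<Sum>l. f l)"
  using sum_le_suminf[of f "{l}"] by simp

text \<open>The gaps of the pair cover all times from \<open>s\<close> on, because its points tend
  to infinity.\<close>

lemma nn_integral_separated_le:
  assumes ij: "i < j" "j < n" and s: "0 \<le> s"
  shows "(\<integral>\<^sup>+X. \<integral>\<^sup>+t. of_bool (s \<le> t) * of_bool (separated n (cost X) k t i j) \<partial>lborel \<partial>poisson_mg n)
    \<le> (\<Sum>l. \<integral>\<^sup>+X. of_bool (s \<le> cost X (i, j, l))
        * of_bool (separated n (cost X) k (cost X (i, j, l)) i j) \<partial>poisson_mg n)"
    (is "?L \<le> _")
proof -
  let ?P = "poisson_mg n"
  let ?g = "\<lambda>X l t. of_bool (s \<le> t \<and> (\<Sum>m<l. X (i, j, m)) \<le> t \<and> t < cost X (i, j, l))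
    * of_bool (separated n (cost X) k t i j) :: ennreal"
  have e: "(i, j, m) \<in> edges n" for m
    using ij by (simp add: edges_def)
  note [measurable] = measurable_cost[OF e] measurable_interarrival[OF e]
  have g: "(\<lambda>w. ?g (fst w) l (snd w)) \<in> borel_measurable (?P \<Otimes>\<^sub>M lborel)" for l
  proof -
    have [measurable]: "(\<lambda>w. of_bool (separated n (cost (fst w)) k (snd w) i j) :: ennreal)
        \<in> borel_measurable (?P \<Otimes>\<^sub>M lborel)"
      by (rule measurable_separated_kernel) measurable
    have [measurable]: "(\<lambda>w. cost (fst w) (i, j, l)) \<in> borel_measurable (?P \<Otimes>\<^sub>M lborel)"
      "(\<lambda>w. fst w (i, j, m)) \<in> borel_measurable (?P \<Otimes>\<^sub>M lborel)" for m
      by (rule measurable_compose[OF measurable_fst]; measurable)+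
    show ?thesis
      by measurable
  qed
  have g': "(\<lambda>t. ?g X l t) \<in> borel_measurable lborel" if "X \<in> space ?P" for X l
    using measurable_compose[OF measurable_Pair1'[OF that] g[of l]] by simp
  have "?L \<le> (\<integral>\<^sup>+X. (\<integral>\<^sup>+t. (\<Sum>l. ?g X l t) \<partial>lborel) \<partial>?P)"
  proof (rule nn_integral_mono_AE, use AE_generic_costs in eventually_elim)
    case (elim X)
    show ?case
    proof (rule nn_integral_mono)
      fix t :: real
      show "of_bool (s \<le> t) * of_bool (separated n (cost X) k t i j) \<le> (\<Sum>l. ?g X l t)"
      proof (cases "s \<le> t")
        case True
        have "\<exists>l. t < cost X (i, j, l)"
        proof (rule ccontr)
          assume "\<not> ?thesis"
          then have "range (\<lambda>l. (i, j, l)) \<subseteq> {f \<in> edges n. cost X f \<le> t}"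
            using e by (auto simp: not_less)
          then have "finite (range (\<lambda>l::nat. (i, j, l)))"
            using generic_costs.fin[OF elim] by (rule finite_subset)
          then show False
            by (simp add: finite_image_iff inj_on_def)
        qed
        \<comment> \<open>The first point after \<open>t\<close> ends the gap that contains
          \<open>t\<close>.\<close>
        then obtain l where l: "t < cost X (i, j, l)" and least: "\<And>l'. l' < l \<Longrightarrow> cost X (i, j, l') \<le> t"
          using exists_least_iff[of "\<lambda>l. t < cost X (i, j, l)"] by (auto simp: not_less)
        have "(\<Sum>m<l. X (i, j, m)) \<le> t"
        proof (cases l)
          case 0
          then show ?thesis using s True by simp
        next
          case (Suc l')
          then show ?thesis
            using least[of l'] by (simp add: cost_def lessThan_Suc_atMost)
        qed
        then have "of_bool (s \<le> t) * of_bool (separated n (cost X) k t i j) = ?g X l t"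
          using True l by simp
        also have "\<dots> \<le> (\<Sum>l. ?g X l t)"
          by (rule term_le_suminf_ennreal)
        finally show ?thesis .
      qed simp
    qed
  qed
  also have "\<dots> = (\<integral>\<^sup>+X. (\<Sum>l. \<integral>\<^sup>+t. ?g X l t \<partial>lborel) \<partial>?P)"
    by (rule nn_integral_cong) (use g' in \<open>rule nn_integral_suminf\<close>)
  also have "\<dots> = (\<Sum>l. \<integral>\<^sup>+X. (\<integral>\<^sup>+t. ?g X l t \<partial>lborel) \<partial>?P)"
    by (rule nn_integral_suminf) (use lborel.borel_measurable_nn_integral_fst[OF g] in simp)
  also have "\<dots> = (\<Sum>l. \<integral>\<^sup>+X. of_bool (s \<le> cost X (i, j, l))
        * of_bool (separated n (cost X) k (cost X (i, j, l)) i j) \<partial>?P)"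
    unfolding nn_integral_separated_interarrival[OF ij] ..
  finally show ?thesis .
qed

section \<open>Sums over the countable edge set\<close>

text \<open>A finite sum of series in \<open>ennreal\<close>, so that expectations may be exchanged
  with it. Sums over a random layer are written with indicators over this fixed index set.\<close>

definition edge_sum :: "nat \<Rightarrow> (edge \<Rightarrow> ennreal) \<Rightarrow> ennreal" where
  "edge_sum n f = (\<Sum>p\<in>pairs n. \<Sum>m. f (fst p, snd p, m))"

lemma pairs_edges: "p \<in> pairs n \<Longrightarrow> (fst p, snd p, m) \<in> edges n"
  by (auto simp: pairs_def edges_def)

lemma edge_sum_mono: "(\<And>e. e \<in> edges n \<Longrightarrow> f e \<le> g e) \<Longrightarrow> edge_sum n f \<le> edge_sum n g"
  unfolding edge_sum_def by (intro sum_mono suminf_le) (auto simp: pairs_edges)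

lemma edge_sum_cong: "(\<And>e. e \<in> edges n \<Longrightarrow> f e = g e) \<Longrightarrow> edge_sum n f = edge_sum n g"
  by (intro antisym edge_sum_mono) auto

lemma edge_sum_add: "edge_sum n (\<lambda>e. f e + g e) = edge_sum n f + edge_sum n g"
  unfolding edge_sum_def by (simp add: suminf_add[symmetric] sum.distrib)

lemma edge_sum_cmult: "edge_sum n (\<lambda>e. a * f e) = a * edge_sum n f"
  unfolding edge_sum_def by (simp add: sum_distrib_left)

lemma edge_sum_sum: "finite I \<Longrightarrow> edge_sum n (\<lambda>e. \<Sum>q\<in>I. f q e) = (\<Sum>q\<in>I. edge_sum n (f q))"
proof (induction I rule: finite_induct)
  case empty
  show ?case by (simp add: edge_sum_def)
qed (simp add: edge_sum_add)

lemma edge_sum_single: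
  assumes "e \<in> edges n"
  shows "edge_sum n (\<lambda>f. of_bool (f = e) * g f) = g e"
proof -
  obtain i j m where e: "e = (i, j, m)"
    by (cases e)
  have "(\<Sum>l. of_bool ((fst p, snd p, l) = e) * g (fst p, snd p, l)) = (if p = (i, j) then g e else 0)" for p
  proof -
    have "(\<Sum>l. of_bool ((fst p, snd p, l) = e) * g (fst p, snd p, l))
        = (\<Sum>l\<in>{m}. of_bool ((fst p, snd p, l) = e) * g (fst p, snd p, l))"
      by (rule suminf_finite) (auto simp: e)
    then show ?thesis
      by (cases p) (auto simp: e)
  qed
  moreover have "(i, j) \<in> pairs n"
    using assms by (simp add: e edges_def pairs_def)
  ultimately show ?thesis
    unfolding edge_sum_def by simp
qed

lemma edge_sum_finite:
  assumes "finite F" "F \<subseteq> edges n"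
  shows "edge_sum n (\<lambda>e. of_bool (e \<in> F) * f e) = (\<Sum>e\<in>F. f e)"
  using assms
proof (induction F rule: finite_induct)
  case empty
  show ?case by (simp add: edge_sum_def)
next
  case (insert x F)
  have "edge_sum n (\<lambda>e. of_bool (e \<in> insert x F) * f e)
      = edge_sum n (\<lambda>e. of_bool (e = x) * f e + of_bool (e \<in> F) * f e)"
    using insert.hyps by (intro edge_sum_cong) (auto simp: of_bool_def)
  then show ?case
    using insert by (simp add: edge_sum_add edge_sum_single)
qed

lemma borel_measurable_edge_sum:
  assumes "\<And>e. e \<in> edges n \<Longrightarrow> f e \<in> borel_measurable M"
  shows "(\<lambda>X. edge_sum n (\<lambda>e. f e X)) \<in> borel_measurable M"
  unfolding edge_sum_def
  by (intro borel_measurable_sum borel_measurable_suminf_order assms pairs_edges)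

lemma nn_integral_edge_sum:
  assumes "\<And>e. e \<in> edges n \<Longrightarrow> f e \<in> borel_measurable M"
  shows "(\<integral>\<^sup>+X. edge_sum n (\<lambda>e. f e X) \<partial>M) = edge_sum n (\<lambda>e. \<integral>\<^sup>+X. f e X \<partial>M)"
proof -
  have "(\<integral>\<^sup>+X. edge_sum n (\<lambda>e. f e X) \<partial>M) = (\<Sum>p\<in>pairs n. \<integral>\<^sup>+X. (\<Sum>m. f (fst p, snd p, m) X) \<partial>M)"
    unfolding edge_sum_def by (intro nn_integral_sum borel_measurable_suminf_order assms pairs_edges)
  also have "\<dots> = edge_sum n (\<lambda>e. \<integral>\<^sup>+X. f e X \<partial>M)"
    unfolding edge_sum_def by (intro sum.cong refl nn_integral_suminf assms pairs_edges)
  finally show ?thesis .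
qed

section \<open>Moment bounds for the excess weight\<close>

text \<open>The total of the positive parts of \<open>cost X e - s\<close> over the layer, since
  \<open>ennreal\<close> sends negative numbers to 0. Unlike \<open>wT\<close> it is visibly
  measurable for all samples.\<close>

definition excess :: "nat \<Rightarrow> nat \<Rightarrow> real \<Rightarrow> (edge \<Rightarrow> real) \<Rightarrow> ennreal" where
  "excess n k s X = edge_sum n (\<lambda>e. of_bool (e \<in> layer n (cost X) k) * ennreal (cost X e - s))"

definition num_above :: "nat \<Rightarrow> nat \<Rightarrow> real \<Rightarrow> (edge \<Rightarrow> real) \<Rightarrow> ennreal" where
  "num_above n k s X = edge_sum n (\<lambda>e. of_bool (e \<in> layer n (cost X) k) * of_bool (s \<le> cost X e))"

lemma measurable_excess [measurable]: "excess n k s \<in> borel_measurable (poisson_mg n)"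
  unfolding excess_def
proof (rule borel_measurable_edge_sum)
  fix e assume "e \<in> edges n"
  note [measurable] = measurable_cost[OF this] pred_layer[OF measurable_ident_sets[OF refl]]
  show "(\<lambda>X. of_bool (e \<in> layer n (cost X) k) * ennreal (cost X e - s)) \<in> borel_measurable (poisson_mg n)"
    by measurable
qed

lemma measurable_num_above [measurable]: "num_above n k s \<in> borel_measurable (poisson_mg n)"
  unfolding num_above_def
proof (rule borel_measurable_edge_sum)
  fix e assume "e \<in> edges n"
  note [measurable] = measurable_cost[OF this] pred_layer[OF measurable_ident_sets[OF refl]]
  show "(\<lambda>X. of_bool (e \<in> layer n (cost X) k) * of_bool (s \<le> cost X e)) \<in> borel_measurable (poisson_mg n)"
    by measurable
qed

lemma excess_eq_sum:
  assumes "generic_costs n (cost X)"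
  shows "excess n k s X = (\<Sum>e\<in>layer n (cost X) k. ennreal (cost X e - s))"
  unfolding excess_def
  using generic_costs.finite_layer[OF assms] generic_costs.layer_subset[OF assms] by (rule edge_sum_finite)

lemma num_above_eq_card:
  assumes "generic_costs n (cost X)"
  shows "num_above n k s X = of_nat (card {e \<in> layer n (cost X) k. s \<le> cost X e})"
proof -
  have "num_above n k s X = (\<Sum>e\<in>layer n (cost X) k. of_bool (s \<le> cost X e))"
    unfolding num_above_def
    using generic_costs.finite_layer[OF assms] generic_costs.layer_subset[OF assms] by (rule edge_sum_finite)
  also have "\<dots> = of_nat (card {e \<in> layer n (cost X) k. s \<le> cost X e})"
    using generic_costs.finite_layer[OF assms, of k] by (simp add: sum_of_bool_eq Int_def)
  finally show ?thesis .
qed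

text \<open>Each positive part is the length of the time interval from \<open>s\<close> to the cost.
  Exchanging sum and integral leaves the number of layer edges of cost at least \<open>t\<close>,
  which \<open>n_card_layer_ge_le\<close> bounds for every \<open>t\<close>.\<close>

lemma excess_le_integral_separated:
  assumes gen: "generic_costs n (cost X)" and X: "X \<in> space (poisson_mg n)"
  shows "of_nat n * excess n k s X
    \<le> 2 * (\<Sum>p\<in>pairs n. \<integral>\<^sup>+t. of_bool (s \<le> t) * of_bool (separated n (cost X) k t (fst p) (snd p)) \<partial>lborel)"
proof -
  let ?T = "layer n (cost X) k"
  have fin: "finite ?T"
    using generic_costs.finite_layer[OF gen] .
  have [measurable]: "(\<lambda>t. of_bool (separated n (cost X) k t u v) :: ennreal) \<in> borel_measurable lborel" for u v
    by (rule measurable_separated_kernel[where X = "\<lambda>_. X"]) (use X in auto)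
  have layer_cake: "ennreal (cost X e - s) = (\<integral>\<^sup>+t. of_bool (s \<le> t) * of_bool (t \<le> cost X e) \<partial>lborel)" for e
  proof -
    have "(\<integral>\<^sup>+t. of_bool (s \<le> t) * of_bool (t \<le> cost X e) \<partial>lborel) = (\<integral>\<^sup>+t. indicator {s..cost X e} t \<partial>lborel)"
      by (rule nn_integral_cong) (auto simp: indicator_def)
    then show ?thesis
      by (auto simp: emeasure_lborel_Icc_eq ennreal_neg)
  qed
  have "of_nat n * excess n k s X
      = of_nat n * (\<integral>\<^sup>+t. (\<Sum>e\<in>?T. of_bool (s \<le> t) * of_bool (t \<le> cost X e)) \<partial>lborel)"
    unfolding excess_eq_sum[OF gen] layer_cake by (subst nn_integral_sum) auto
  also have "\<dots> = (\<integral>\<^sup>+t. of_bool (s \<le> t) * of_nat (n * card {e \<in> ?T. t \<le> cost X e}) \<partial>lborel)"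
  proof (subst nn_integral_cmult[symmetric])
    have "(\<Sum>e\<in>?T. of_bool (s \<le> t) * of_bool (t \<le> cost X e))
        = of_bool (s \<le> t) * (of_nat (card {e \<in> ?T. t \<le> cost X e}) :: ennreal)" for t
      using fin by (simp add: sum_distrib_left[symmetric] sum_of_bool_eq Int_def)
    then show "(\<integral>\<^sup>+t. of_nat n * (\<Sum>e\<in>?T. of_bool (s \<le> t) * of_bool (t \<le> cost X e)) \<partial>lborel)
        = (\<integral>\<^sup>+t. of_bool (s \<le> t) * of_nat (n * card {e \<in> ?T. t \<le> cost X e}) \<partial>lborel)"
      by (simp add: mult.left_commute)
  qed measurable
  also have "\<dots> \<le> (\<integral>\<^sup>+t. 2 * (\<Sum>p\<in>pairs n. of_bool (s \<le> t) * of_bool (separated n (cost X) k t (fst p) (snd p))) \<partial>lborel)"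
  proof (rule nn_integral_mono)
    fix t :: real
    have "of_nat (n * card {e \<in> ?T. t \<le> cost X e})
        \<le> (of_nat (2 * card {(i, j). (i, j) \<in> pairs n \<and> separated n (cost X) k t i j}) :: ennreal)"
      using generic_costs.n_card_layer_ge_le[OF gen, of k t] by (simp only: of_nat_le_iff)
    also have "{(i, j). (i, j) \<in> pairs n \<and> separated n (cost X) k t i j}
        = {p \<in> pairs n. separated n (cost X) k t (fst p) (snd p)}"
      by (auto simp: case_prod_unfold)
    also have "of_nat (2 * card {p \<in> pairs n. separated n (cost X) k t (fst p) (snd p)})
        = 2 * (\<Sum>p\<in>pairs n. of_bool (separated n (cost X) k t (fst p) (snd p)) :: ennreal)"
      by (simp add: sum_of_bool_eq Int_def)
    finally have "of_bool (s \<le> t) * of_nat (n * card {e \<in> ?T. t \<le> cost X e})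
      \<le> of_bool (s \<le> t) * (2 * (\<Sum>p\<in>pairs n. of_bool (separated n (cost X) k t (fst p) (snd p)) :: ennreal))"
      by (rule mult_left_mono) simp
    then show "(of_bool (s \<le> t) * of_nat (n * card {e \<in> ?T. t \<le> cost X e}) :: ennreal)
      \<le> 2 * (\<Sum>p\<in>pairs n. of_bool (s \<le> t) * of_bool (separated n (cost X) k t (fst p) (snd p)))"
      unfolding sum_distrib_left[symmetric] mult.left_commute[of 2] .
  qed
  also have "\<dots> = 2 * (\<Sum>p\<in>pairs n. \<integral>\<^sup>+t. of_bool (s \<le> t) * of_bool (separated n (cost X) k t (fst p) (snd p)) \<partial>lborel)"
  proof (subst nn_integral_cmult)
    show "2 * (\<integral>\<^sup>+t. (\<Sum>p\<in>pairs n. of_bool (s \<le> t) * of_bool (separated n (cost X) k t (fst p) (snd p))) \<partial>lborel)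
      = 2 * (\<Sum>p\<in>pairs n. \<integral>\<^sup>+t. of_bool (s \<le> t) * of_bool (separated n (cost X) k t (fst p) (snd p)) \<partial>lborel)"
      by (intro arg_cong[where f = "(*) 2"] nn_integral_sum) measurable
  qed measurable
  finally show ?thesis .
qed

lemma nn_integral_excess_le_num_above:
  assumes s: "0 \<le> s"
  shows "of_nat n * (\<integral>\<^sup>+X. excess n k s X \<partial>poisson_mg n)
    \<le> 2 * (\<Sum>q\<le>k. \<integral>\<^sup>+X. num_above n q s X \<partial>poisson_mg n)"
proof -
  let ?P = "poisson_mg n"
  let ?sep = "\<lambda>X t p. of_bool (separated n (cost X) k t (fst p) (snd p)) :: ennreal"
  define h :: "edge \<Rightarrow> (edge \<Rightarrow> real) \<Rightarrow> ennreal"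
    where "h e X = of_bool (s \<le> cost X e) * ?sep X (cost X e) (fst e, fst (snd e))" for e X
  have h: "h e \<in> borel_measurable ?P" if "e \<in> edges n" for e
  proof -
    note [measurable] = measurable_cost[OF that]
    have [measurable]: "(\<lambda>X. ?sep X (cost X e) (fst e, fst (snd e))) \<in> borel_measurable ?P"
      by (rule measurable_separated_kernel) measurable
    show ?thesis
      unfolding h_def by measurable
  qed
  have inner: "(\<lambda>X. \<integral>\<^sup>+t. of_bool (s \<le> t) * ?sep X t p \<partial>lborel) \<in> borel_measurable ?P" for p
  proof -
    have [measurable]: "(\<lambda>w. ?sep (fst w) (snd w) p) \<in> borel_measurable (?P \<Otimes>\<^sub>M lborel)"
      by (rule measurable_separated_kernel) measurable
    have "(\<lambda>w. of_bool (s \<le> snd w) * ?sep (fst w) (snd w) p) \<in> borel_measurable (?P \<Otimes>\<^sub>M lborel)"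
      by measurable
    from lborel.borel_measurable_nn_integral_fst[OF this] show ?thesis
      by simp
  qed
  have "of_nat n * (\<integral>\<^sup>+X. excess n k s X \<partial>?P) = (\<integral>\<^sup>+X. of_nat n * excess n k s X \<partial>?P)"
    by (rule nn_integral_cmult[symmetric]) measurable
  also have "\<dots> \<le> (\<integral>\<^sup>+X. 2 * (\<Sum>p\<in>pairs n. \<integral>\<^sup>+t. of_bool (s \<le> t) * ?sep X t p \<partial>lborel) \<partial>?P)"
    by (rule nn_integral_mono_AE, use AE_generic_costs AE_space in eventually_elim)
      (rule excess_le_integral_separated)
  also have "\<dots> = 2 * (\<Sum>p\<in>pairs n. \<integral>\<^sup>+X. (\<integral>\<^sup>+t. of_bool (s \<le> t) * ?sep X t p \<partial>lborel) \<partial>?P)"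
    by (subst nn_integral_cmult, intro borel_measurable_sum inner)
      (subst nn_integral_sum, rule inner, rule refl)
  \<comment> \<open>Here separated time turns into the expected number of points that find their
    pair separated.\<close>
  also have "\<dots> \<le> 2 * (\<Sum>p\<in>pairs n. \<Sum>m. \<integral>\<^sup>+X. h (fst p, snd p, m) X \<partial>?P)"
    unfolding h_def fst_conv snd_conv
    by (intro mult_left_mono sum_mono nn_integral_separated_le s) (auto simp: pairs_def)
  also have "\<dots> = 2 * (\<integral>\<^sup>+X. edge_sum n (\<lambda>e. h e X) \<partial>?P)"
    by (subst nn_integral_edge_sum, rule h, assumption) (simp only: edge_sum_def)
  \<comment> \<open>By \<open>separated_own_cost\<close> each counted point is an edge of one of the
    layers up to \<open>k\<close>.\<close>
  also have "\<dots> \<le> 2 * (\<integral>\<^sup>+X. (\<Sum>q\<le>k. num_above n q s X) \<partial>?P)"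
  proof (intro mult_left_mono nn_integral_mono)
    fix X
    have "edge_sum n (\<lambda>e. h e X)
        \<le> edge_sum n (\<lambda>e. \<Sum>q\<le>k. of_bool (e \<in> layer n (cost X) q) * of_bool (s \<le> cost X e))"
    proof (rule edge_sum_mono)
      fix e assume e: "e \<in> edges n"
      obtain i j m where eq: "e = (i, j, m)"
        by (cases e)
      show "h e X \<le> (\<Sum>q\<le>k. of_bool (e \<in> layer n (cost X) q) * of_bool (s \<le> cost X e))"
      proof (cases "s \<le> cost X e \<and> separated n (cost X) k (cost X e) i j")
        case True
        then obtain q where q: "q \<le> k" "e \<in> layer n (cost X) q"
          using separated_own_cost e unfolding eq by blast
        have "h e X = of_bool (e \<in> layer n (cost X) q) * of_bool (s \<le> cost X e)"
          using True q by (simp add: h_def eq)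
        also have "\<dots> \<le> (\<Sum>q\<le>k. of_bool (e \<in> layer n (cost X) q) * of_bool (s \<le> cost X e))"
          using q(1) by (intro member_le_sum[of q "{..k}" "\<lambda>q. of_bool (e \<in> layer n (cost X) q) * of_bool (s \<le> cost X e)"]) auto
        finally show ?thesis .
      next
        case False
        then have "h e X = 0"
          by (auto simp: h_def eq)
        then show ?thesis by simp
      qed
    qed
    then show "edge_sum n (\<lambda>e. h e X) \<le> (\<Sum>q\<le>k. num_above n q s X)"
      by (simp only: edge_sum_sum[OF finite_atMost] num_above_def)
  qed simp
  also have "\<dots> = 2 * (\<Sum>q\<le>k. \<integral>\<^sup>+X. num_above n q s X \<partial>?P)"
    by (subst nn_integral_sum) auto
  finally show ?thesis .
qed

text \<open>Each of the \<open>Suc k\<close> layers has at most \<open>n\<close> edges, and the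
  factor \<open>n\<close> cancels.\<close>

lemma nn_integral_excess_0_le:
  assumes "0 < n"
  shows "(\<integral>\<^sup>+X. excess n k 0 X \<partial>poisson_mg n) \<le> of_nat (2 * Suc k)"
proof -
  interpret P: prob_space "poisson_mg n" by (rule prob_space_poisson_mg)
  have "(\<integral>\<^sup>+X. num_above n q 0 X \<partial>poisson_mg n) \<le> (\<integral>\<^sup>+X. of_nat n \<partial>poisson_mg n)" for q
  proof (rule nn_integral_mono_AE, use AE_generic_costs in eventually_elim)
    case (elim X)
    have "card {e \<in> layer n (cost X) q. 0 \<le> cost X e} \<le> card (layer n (cost X) q)"
      using generic_costs.finite_layer[OF elim] by (intro card_mono) auto
    also have "\<dots> \<le> n"
      using generic_costs.card_layer[OF elim] by simp
    finally show ?case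
      unfolding num_above_eq_card[OF elim] by (simp only: of_nat_le_iff)
  qed
  then have num: "(\<integral>\<^sup>+X. num_above n q 0 X \<partial>poisson_mg n) \<le> of_nat n" for q
    by (simp add: P.emeasure_space_1)
  have "of_nat n * (\<integral>\<^sup>+X. excess n k 0 X \<partial>poisson_mg n)
      \<le> 2 * (\<Sum>q\<le>k. \<integral>\<^sup>+X. num_above n q 0 X \<partial>poisson_mg n)"
    by (rule nn_integral_excess_le_num_above) simp
  also have "\<dots> \<le> 2 * (\<Sum>q\<le>k. of_nat n)"
    by (intro mult_left_mono sum_mono num) simp
  also have "\<dots> = of_nat n * of_nat (2 * Suc k)"
    by (simp only: sum_constant card_atMost of_nat_mult of_nat_numeral mult_ac)
  finally show ?thesis
    using assms by (subst (asm) ennreal_mult_le_mult_iff) auto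
qed

text \<open>Markov's inequality: \<open>s\<close> times the number of edges of cost at least
  \<open>s\<close> is at most the total cost of the layer, whose mean is at most
  \<open>2 * Suc k\<close>. With \<open>s = C / n\<close> the product of \<open>s\<close> and
  \<open>n\<close> is \<open>C\<close>.\<close>

lemma nn_integral_excess_le:
  assumes "0 < n" "0 < C"
  shows "ennreal C * (\<integral>\<^sup>+X. excess n k (C / n) X \<partial>poisson_mg n) \<le> of_nat (4 * (Suc k)\<^sup>2)"
proof -
  let ?P = "poisson_mg n"
  define s where "s = C / n"
  have s: "0 < s"
    using assms by (simp add: s_def)
  have num: "ennreal s * (\<integral>\<^sup>+X. num_above n q s X \<partial>?P) \<le> of_nat (2 * Suc k)" if "q \<le> k" for q
  proof -
    have "ennreal s * (\<integral>\<^sup>+X. num_above n q s X \<partial>?P) = (\<integral>\<^sup>+X. ennreal s * num_above n q s X \<partial>?P)"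
      by (rule nn_integral_cmult[symmetric]) measurable
    also have "\<dots> \<le> (\<integral>\<^sup>+X. excess n q 0 X \<partial>?P)"
    proof (rule nn_integral_mono)
      fix X
      show "ennreal s * num_above n q s X \<le> excess n q 0 X"
        unfolding num_above_def excess_def edge_sum_cmult[symmetric]
        by (rule edge_sum_mono) (auto intro: ennreal_leI)
    qed
    also have "\<dots> \<le> of_nat (2 * Suc q)"
      using assms(1) by (rule nn_integral_excess_0_le)
    also have "\<dots> \<le> of_nat (2 * Suc k)"
      using that by (intro of_nat_mono) simp
    finally show ?thesis .
  qed
  have C: "ennreal C = ennreal s * of_nat n"
    using assms s by (simp add: s_def ennreal_of_nat_eq_real_of_nat ennreal_mult[symmetric])
  have "ennreal C * (\<integral>\<^sup>+X. excess n k s X \<partial>?P) = ennreal s * (of_nat n * (\<integral>\<^sup>+X. excess n k s X \<partial>?P))"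
    by (simp add: C mult.assoc)
  also have "\<dots> \<le> ennreal s * (2 * (\<Sum>q\<le>k. \<integral>\<^sup>+X. num_above n q s X \<partial>?P))"
    using s by (intro mult_left_mono nn_integral_excess_le_num_above) auto
  also have "\<dots> = 2 * (\<Sum>q\<le>k. ennreal s * (\<integral>\<^sup>+X. num_above n q s X \<partial>?P))"
    by (simp add: sum_distrib_left mult.left_commute)
  also have "\<dots> \<le> 2 * (\<Sum>q\<le>k. of_nat (2 * Suc k))"
    by (intro mult_left_mono sum_mono num) auto
  also have "\<dots> = of_nat (2 * (Suc k * (2 * Suc k)))"
    by (simp only: sum_constant card_atMost of_nat_mult of_nat_numeral)
  also have "2 * (Suc k * (2 * Suc k)) = 4 * (Suc k)\<^sup>2"
    by (simp add: power2_eq_square)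
  finally show ?thesis
    by (simp only: s_def)
qed

text \<open>The costs truncated at \<open>C / n\<close> sum to at most
  \<open>(n - 1) * C / n\<close> over the \<open>n - 1\<close> edges.\<close>

lemma excess_0_le:
  assumes "generic_costs n (cost X)" "0 < n" "0 < C"
  shows "excess n k 0 X \<le> ennreal C + excess n k (C / n) X"
proof -
  let ?T = "layer n (cost X) k"
  have "excess n k 0 X \<le> (\<Sum>e\<in>?T. ennreal (C / n) + ennreal (cost X e - C / n))"
    unfolding excess_eq_sum[OF assms(1)]
  proof (rule sum_mono)
    fix e
    show "ennreal (cost X e - 0) \<le> ennreal (C / n) + ennreal (cost X e - C / n)"
      using assms(3) by (cases "C / n \<le> cost X e")
        (simp_all add: ennreal_plus[symmetric] ennreal_neg ennreal_leI del: ennreal_plus)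
  qed
  also have "\<dots> = of_nat (n - 1) * ennreal (C / n) + excess n k (C / n) X"
    by (simp add: sum.distrib generic_costs.card_layer[OF assms(1)] excess_eq_sum[OF assms(1)])
  also have "of_nat (n - 1) * ennreal (C / n) \<le> of_nat n * ennreal (C / n)"
    by (intro mult_right_mono of_nat_mono) simp_all
  also have "of_nat n * ennreal (C / n) = ennreal C"
    using assms by (simp add: ennreal_of_nat_eq_real_of_nat ennreal_mult[symmetric])
  finally show ?thesis by simp
qed

lemma wT_eq_excess:
  assumes "generic_costs n (cost X)"
  shows "0 \<le> wT n (Suc k) X" "ennreal (wT n (Suc k) X) = excess n k 0 X"
proof -
  have w: "wT n (Suc k) X = (\<Sum>e\<in>layer n (cost X) k. cost X e)"
    by (simp add: wT_def weight_def generic_costs.kth_mst_eq_layer[OF assms])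
  have pos: "0 \<le> cost X e" if "e \<in> layer n (cost X) k" for e
    using generic_costs.pos[OF assms] generic_costs.layer_subset[OF assms] that less_imp_le by blast
  show "0 \<le> wT n (Suc k) X"
    unfolding w using pos by (rule sum_nonneg)
  show "ennreal (wT n (Suc k) X) = excess n k 0 X"
    unfolding w excess_eq_sum[OF assms] using pos by (simp add: sum_ennreal)
qed

subsection \<open>Passing to the limit\<close>

text \<open>As \<open>wT\<close> rests on \<open>SOME\<close>, its event is only shown to agree with
  a measurable one off a null set, which puts it into the completion.\<close>

lemma measure_completion_wT:
  fixes \<gamma> \<epsilon> :: real and n k :: nat
  defines "W \<equiv> \<lambda>X. enn2real (excess n k 0 X)"
  shows "measure (completion (poisson_mg n)) {X \<in> space (poisson_mg n). \<bar>wT n (Suc k) X - \<gamma>\<bar> > \<epsilon>}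
    = measure (poisson_mg n) {X \<in> space (poisson_mg n). \<bar>W X - \<gamma>\<bar> > \<epsilon>}"
proof -
  let ?P = "poisson_mg n"
  let ?A = "{X \<in> space ?P. \<bar>wT n (Suc k) X - \<gamma>\<bar> > \<epsilon>}"
  let ?B = "{X \<in> space ?P. \<bar>W X - \<gamma>\<bar> > \<epsilon>}"
  have [measurable]: "W \<in> borel_measurable ?P"
    unfolding W_def by measurable
  have B: "?B \<in> sets ?P"
    by measurable
  have W: "AE X in ?P. W X = wT n (Suc k) X"
    using AE_generic_costs
  proof eventually_elim
    case (elim X)
    show ?case
      unfolding W_def wT_eq_excess(2)[OF elim, symmetric] using wT_eq_excess(1)[OF elim] by simp
  qed
  then obtain N where N: "\<And>X. X \<in> space ?P - N \<Longrightarrow> W X = wT n (Suc k) X" "N \<in> null_sets ?P"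
    by (rule AE_E3) blast
  have "?A \<in> sets (completion ?P)"
  proof (rule sets_completionI)
    show "?A = (?B - N) \<union> (?A \<inter> N)"
      using N(1) by auto
    show "?A \<inter> N \<subseteq> N" by simp
    show "N \<in> null_sets ?P" by fact
    show "?B - N \<in> sets ?P"
      using B N(2) by auto
  qed
  moreover have "?B \<in> sets (completion ?P)"
    using B by (rule sets_completionI_sets)
  moreover have "AE X in completion ?P. X \<in> ?A \<longleftrightarrow> X \<in> ?B"
    using AE_completion[OF W] by eventually_elim simp
  ultimately have "measure (completion ?P) ?A = measure (completion ?P) ?B"
    by (intro measure_eq_AE)
  then show ?thesis
    using B by simp
qed

text \<open>On the deviation event the truncated weight is at most \<open>C\<close>, so that event
  costs at most \<open>C\<close> times its probability; off the event the weight is within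
  \<open>\<epsilon>\<close> of \<open>\<gamma>\<close>.\<close>

lemma excess_bounds:
  fixes \<gamma> \<epsilon> C :: real and n k :: nat
  assumes gen: "generic_costs n (cost X)" and n: "0 < n" and C: "0 < C" and \<gamma>: "0 \<le> \<gamma>" and \<epsilon>: "0 < \<epsilon>"
  defines "W \<equiv> enn2real (excess n k 0 X)"
  defines "D \<equiv> of_bool (\<bar>W - \<gamma>\<bar> > \<epsilon>) :: ennreal"
  shows "excess n k 0 X \<le> ennreal (\<gamma> + \<epsilon>) + ennreal C * D + excess n k (C / n) X"
    and "ennreal \<gamma> \<le> excess n k 0 X + ennreal \<epsilon> + ennreal \<gamma> * D"
proof -
  have W: "excess n k 0 X = ennreal W" "0 \<le> W"
    unfolding W_def wT_eq_excess(2)[OF gen, symmetric] using wT_eq_excess(1)[OF gen] by simp_all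
  show "excess n k 0 X \<le> ennreal (\<gamma> + \<epsilon>) + ennreal C * D + excess n k (C / n) X"
  proof (cases "\<bar>W - \<gamma>\<bar> > \<epsilon>")
    case True
    have "excess n k 0 X \<le> ennreal C + excess n k (C / n) X"
      by (rule excess_0_le[OF gen n C])
    also have "\<dots> \<le> ennreal (\<gamma> + \<epsilon>) + (ennreal C + excess n k (C / n) X)"
      by (rule add_increasing) simp_all
    finally show ?thesis
      using True by (simp add: D_def add.assoc)
  next
    case False
    then have "excess n k 0 X \<le> ennreal (\<gamma> + \<epsilon>)"
      unfolding W(1) by (intro ennreal_leI) auto
    also have "\<dots> \<le> ennreal (\<gamma> + \<epsilon>) + (ennreal C * D + excess n k (C / n) X)"
      by (rule add_increasing2) simp_all
    finally show ?thesis
      by (simp only: add.assoc)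
  qed
  show "ennreal \<gamma> \<le> excess n k 0 X + ennreal \<epsilon> + ennreal \<gamma> * D"
  proof (cases "\<bar>W - \<gamma>\<bar> > \<epsilon>")
    case True
    then show ?thesis
      by (auto simp: D_def intro: add_increasing)
  next
    case False
    then have "ennreal \<gamma> \<le> ennreal (W + \<epsilon>)"
      by (intro ennreal_leI) auto
    also have "\<dots> = excess n k 0 X + ennreal \<epsilon>"
      using W \<epsilon> by simp
    also have "\<dots> \<le> excess n k 0 X + ennreal \<epsilon> + ennreal \<gamma> * D"
      by (rule add_increasing2) simp_all
    finally show ?thesis .
  qed
qed

text \<open>Integrating both bounds of \<open>excess_bounds\<close>. The last term does not depend
  on \<open>n\<close>, so \<open>C\<close> can be fixed before \<open>n\<close> grows.\<close>

lemma expected_excess_close: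
  fixes \<gamma> \<epsilon> C :: real and n k :: nat
  assumes n: "0 < n" and C: "0 < C" and \<gamma>: "0 \<le> \<gamma>" and \<epsilon>: "0 < \<epsilon>"
  defines "p \<equiv> measure (poisson_mg n) {X \<in> space (poisson_mg n). \<bar>enn2real (excess n k 0 X) - \<gamma>\<bar> > \<epsilon>}"
  shows "\<bar>enn2real (\<integral>\<^sup>+X. excess n k 0 X \<partial>poisson_mg n) - \<gamma>\<bar> \<le> \<epsilon> + (C + \<gamma>) * p + 4 * (real (Suc k))\<^sup>2 / C"
proof -
  let ?P = "poisson_mg n"
  interpret P: prob_space ?P by (rule prob_space_poisson_mg)
  let ?K = "4 * (real (Suc k))\<^sup>2"
  define D :: "(edge \<Rightarrow> real) \<Rightarrow> ennreal" where "D X = of_bool (\<bar>enn2real (excess n k 0 X) - \<gamma>\<bar> > \<epsilon>)" for X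
  have [measurable]: "D \<in> borel_measurable ?P"
    unfolding D_def by measurable
  have p: "0 \<le> p"
    by (simp add: p_def)
  have D: "(\<integral>\<^sup>+X. D X \<partial>?P) = ennreal p"
  proof -
    let ?B = "{X \<in> space ?P. \<bar>enn2real (excess n k 0 X) - \<gamma>\<bar> > \<epsilon>}"
    have "?B \<in> sets ?P"
      by measurable
    moreover have "(\<integral>\<^sup>+X. D X \<partial>?P) = (\<integral>\<^sup>+X. indicator ?B X \<partial>?P)"
      by (rule nn_integral_cong) (simp add: D_def indicator_def)
    ultimately show ?thesis
      by (simp add: p_def P.emeasure_eq_measure)
  qed
  define I where "I = enn2real (\<integral>\<^sup>+X. excess n k 0 X \<partial>?P)"
  have "(\<integral>\<^sup>+X. excess n k 0 X \<partial>?P) < \<infinity>"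
    using nn_integral_excess_0_le[OF n, of k] by (rule order_le_less_trans) (simp add: ennreal_of_nat_eq_real_of_nat)
  then have I: "(\<integral>\<^sup>+X. excess n k 0 X \<partial>?P) = ennreal I" "0 \<le> I"
    by (simp_all add: I_def)
  have Y: "(\<integral>\<^sup>+X. excess n k (C / n) X \<partial>?P) \<le> ennreal (?K / C)"
  proof -
    have "ennreal C * (\<integral>\<^sup>+X. excess n k (C / n) X \<partial>?P) \<le> of_nat (4 * (Suc k)\<^sup>2)"
      by (rule nn_integral_excess_le[OF n C])
    also have "\<dots> = ennreal C * ennreal (?K / C)"
      using C by (simp add: ennreal_of_nat_eq_real_of_nat ennreal_mult[symmetric])
    finally show ?thesis
      using C by (subst (asm) ennreal_mult_le_mult_iff) auto
  qed
  have "ennreal I \<le> (\<integral>\<^sup>+X. ennreal (\<gamma> + \<epsilon>) + ennreal C * D X + excess n k (C / n) X \<partial>?P)"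
    unfolding I(1)[symmetric] D_def
    by (rule nn_integral_mono_AE, use AE_generic_costs in eventually_elim)
      (rule excess_bounds(1)[OF _ n C \<gamma> \<epsilon>])
  also have "\<dots> = ennreal (\<gamma> + \<epsilon>) + ennreal C * ennreal p + (\<integral>\<^sup>+X. excess n k (C / n) X \<partial>?P)"
    by (simp add: nn_integral_add nn_integral_cmult D P.emeasure_space_1)
  also have "\<dots> \<le> ennreal (\<gamma> + \<epsilon>) + ennreal C * ennreal p + ennreal (?K / C)"
    by (rule add_left_mono[OF Y])
  also have "\<dots> = ennreal (\<gamma> + \<epsilon> + C * p + ?K / C)"
    using C \<gamma> \<epsilon> p by (simp add: ennreal_mult ennreal_plus)
  finally have upper: "I \<le> \<gamma> + \<epsilon> + C * p + ?K / C"
    using C \<gamma> \<epsilon> p by (subst (asm) ennreal_le_iff) auto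
  have "ennreal \<gamma> = (\<integral>\<^sup>+X. ennreal \<gamma> \<partial>?P)"
    by (simp add: P.emeasure_space_1)
  also have "\<dots> \<le> (\<integral>\<^sup>+X. excess n k 0 X + ennreal \<epsilon> + ennreal \<gamma> * D X \<partial>?P)"
    unfolding D_def
    by (rule nn_integral_mono_AE, use AE_generic_costs in eventually_elim)
      (rule excess_bounds(2)[OF _ n C \<gamma> \<epsilon>])
  also have "\<dots> = ennreal I + ennreal \<epsilon> + ennreal \<gamma> * ennreal p"
    by (simp add: nn_integral_add nn_integral_cmult D I(1) P.emeasure_space_1)
  also have "\<dots> = ennreal (I + \<epsilon> + \<gamma> * p)"
    using I(2) \<gamma> \<epsilon> p by (simp add: ennreal_mult ennreal_plus)
  finally have lower: "\<gamma> \<le> I + \<epsilon> + \<gamma> * p"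
    using I(2) \<gamma> \<epsilon> p by (subst (asm) ennreal_le_iff) auto
  have "0 \<le> C * p" "0 \<le> \<gamma> * p" "0 \<le> ?K / C"
    using C \<gamma> p by auto
  then show ?thesis
    using upper lower unfolding I_def[symmetric] abs_le_iff distrib_right by auto
qed

theorem theorem1p3:
  fixes k :: nat and \<gamma> :: real
  assumes "k \<ge> 1"
    and "\<forall>\<epsilon>>0. (\<lambda>n. measure (completion (poisson_mg n))
                 {X \<in> space (poisson_mg n). \<bar>wT n k X - \<gamma>\<bar> > \<epsilon>}) \<longlonglongrightarrow> 0"
  shows "(\<lambda>n. \<integral>\<^sup>+ X. ennreal (wT n k X) \<partial>(completion (poisson_mg n))) \<longlonglongrightarrow> ennreal \<gamma>"
proof -
  obtain q where k: "k = Suc q"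
    using assms(1) by (cases k) auto
  define W where "W n X = enn2real (excess n q 0 X)" for n X
  define p where "p \<epsilon> n = measure (poisson_mg n) {X \<in> space (poisson_mg n). \<bar>W n X - \<gamma>\<bar> > \<epsilon>}" for \<epsilon> n
  have p: "p \<epsilon> \<longlonglongrightarrow> 0" if "0 < \<epsilon>" for \<epsilon>
    using assms(2) that unfolding k measure_completion_wT p_def W_def by blast
  \<comment> \<open>A negative \<open>\<gamma>\<close> would keep the nonnegative weights at
    distance more than \<open>- \<gamma> / 2\<close> with probability 1. Nonnegativity also makes
    \<open>ennreal \<gamma>\<close> faithful.\<close>
  have \<gamma>: "0 \<le> \<gamma>"
  proof (rule ccontr)
    assume neg: "\<not> 0 \<le> \<gamma>"
    have "p (- \<gamma> / 2) n = 1" for n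
    proof -
      interpret P: prob_space "poisson_mg n" by (rule prob_space_poisson_mg)
      have "- \<gamma> / 2 < \<bar>W n X - \<gamma>\<bar>" for X
        using neg enn2real_nonneg[of "excess n q 0 X"] unfolding W_def by linarith
      then show ?thesis
        by (simp add: p_def P.prob_space)
    qed
    then have "p (- \<gamma> / 2) = (\<lambda>_. 1)"
      by blast
    then show False
      using p[of "- \<gamma> / 2"] neg by (simp add: LIMSEQ_const_iff)
  qed
  define I where "I n = enn2real (\<integral>\<^sup>+X. excess n q 0 X \<partial>poisson_mg n)" for n
  have "I \<longlonglongrightarrow> \<gamma>"
  proof (rule tendstoI)
    fix \<delta> :: real assume \<delta>: "0 < \<delta>"
    define K where "K = 4 * (real (Suc q))\<^sup>2"
    have K: "0 < K"
      by (simp add: K_def)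
    \<comment> \<open>Chosen so that \<open>K / C\<close> is \<open>\<delta> / 3\<close>, one of
      three equal shares of \<open>\<delta>\<close>.\<close>
    define C where "C = 3 * K / \<delta>"
    have C: "0 < C"
      using K \<delta> by (simp add: C_def)
    have "(\<lambda>n. (C + \<gamma>) * p (\<delta> / 3) n) \<longlonglongrightarrow> (C + \<gamma>) * 0"
      using \<delta> by (intro tendsto_mult_left p) simp
    then have "\<forall>\<^sub>F n in sequentially. (C + \<gamma>) * p (\<delta> / 3) n < \<delta> / 3"
      using \<delta> by (intro order_tendstoD(2)) auto
    then show "\<forall>\<^sub>F n in sequentially. dist (I n) \<gamma> < \<delta>"
      using eventually_gt_at_top[of 0]
    proof eventually_elim
      case (elim n)
      have "\<bar>I n - \<gamma>\<bar> \<le> \<delta> / 3 + (C + \<gamma>) * p (\<delta> / 3) n + K / C"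
        unfolding I_def p_def W_def K_def using elim C \<gamma> \<delta> by (intro expected_excess_close) auto
      also have "K / C = \<delta> / 3"
        using K \<delta> by (simp add: C_def)
      finally show ?case
        using elim by (simp add: dist_real_def)
    qed
  qed
  then have "(\<lambda>n. ennreal (I n)) \<longlonglongrightarrow> ennreal \<gamma>"
    by (rule tendsto_ennrealI)
  \<comment> \<open>For positive \<open>n\<close> the mean is finite, so \<open>enn2real\<close>
    loses nothing in \<open>I\<close>.\<close>
  moreover have "\<forall>\<^sub>F n in sequentially. ennreal (I n) = (\<integral>\<^sup>+ X. ennreal (wT n k X) \<partial>(completion (poisson_mg n)))"
    using eventually_gt_at_top[of 0]
  proof eventually_elim
    case (elim n)
    have "(\<integral>\<^sup>+X. excess n q 0 X \<partial>poisson_mg n) < \<infinity>"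
      using nn_integral_excess_0_le[OF elim, of q]
      by (rule order_le_less_trans) (simp add: ennreal_of_nat_eq_real_of_nat)
    then have "ennreal (I n) = (\<integral>\<^sup>+X. excess n q 0 X \<partial>poisson_mg n)"
      by (simp add: I_def)
    also have "\<dots> = (\<integral>\<^sup>+ X. ennreal (wT n k X) \<partial>poisson_mg n)"
      unfolding k by (rule nn_integral_cong_AE, use AE_generic_costs in eventually_elim)
        (simp only: wT_eq_excess)
    finally show ?case
      by (simp only: nn_integral_completion)
  qed
  ultimately show ?thesis
    by (rule Lim_transform_eventually)
qed

end
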